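(* For each $n$ let $Y_1,\dots,Y_n$ be i.i.d. observations in $\mathbb R^{p_n}$ from the model $$Y_i=f(\upsilon)+\varepsilon_i,\qquad f(\upsilon)=f(\theta,\eta)=(\theta+\|\eta\|^2,\eta_1,\dots,\eta_{p_n-1})^\top,\qquad\varepsilon_i\sim\mathcal N(0,I_{p_n}),$$ with $\upsilon=(\theta,\eta)\in\mathbb R\times\mathbb R^{p_n-1}$, parameter of interest $\theta$, and true parameter $\upsilon^*=0$ (so $\theta^*=0$). Let $\tilde\theta$ be the profile MLE of $\theta$. Then: (i) if $p_n/\sqrt n\to0$, the Fisher expansion is accurate, i.e. $\sqrt n(\tilde\theta-\theta^* )-\breve\xi\to0$ in probability; (ii) if $p_n/\sqrt n\not\to0$, the profile MLE $\tilde\theta$ is not root-$n$ consistent; (iii) if $\sqrt n=o(p_n)$, the root-$n$ bias $|\sqrt n(\tilde\theta-\theta^* )-\breve\xi|$ tends to infinity almost surely; (iv) the Wilks phenomenon, i.e. $2\{\breve L(\tilde\theta)-\breve L(\theta^* )\}\to\chi^2_1$ in distribution, occurs if and only if $p_n=o(\sqrt n)$.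
   Context: The log-likelihood is, up to an additive constant, $\mathcal L(\theta,\eta)=-\frac12\sum_{i=1}^n\|Y_i-f(\theta,\eta)\|^2$. The profile likelihood is $\breve L(\theta)=\max_{\eta\in\mathbb R^{p_n-1}}\mathcal L(\theta,\eta)$ and the profile MLE is $\tilde\theta=\operatorname{argmax}_\theta\breve L(\theta)$, i.e. the $\theta$-component of the full MLE. Here $\breve D^2=n$ is the efficient information and $\breve\xi=n^{-1/2}\sum_{i=1}^n(\varepsilon_i)_1$ is the normalized efficient score at the true parameter, where $(\varepsilon_i)_1$ is the first coordinate of $\varepsilon_i$.
   Formalization: In (ii), "root-n consistent" means bounded in probability at rate root-n with every subsequential limit law centred; plain O_P(1) fails to be violated for p_n of order √n (limit N(-1,1) if p_n=⌈√n⌉). Failure of O_P(1) itself is stated when p_n/√n is unbounded. *)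

theory Defs
  imports "HOL-Probability.Probability" "HOL-Library.Landau_Symbols"
begin

text \<open>
  The dimension varies with the sample size, so a vector in p-dimensional space is a function on
  \<open>nat\<close> of which only the coordinates \<open>0, ..., p - 1\<close> matter.  Coordinate \<open>0\<close> is the first one;
  the nuisance vector \<open>\<eta>\<close> occupies the coordinates \<open>1, ..., p - 1\<close>.
\<close>

definition model_map :: "nat \<Rightarrow> real \<Rightarrow> (nat \<Rightarrow> real) \<Rightarrow> nat \<Rightarrow> real" where
  "model_map p \<theta> \<eta> j = (if j = 0 then \<theta> + (L2_set \<eta> {1..<p})\<^sup>2 else \<eta> j)"

definition nuisance_space :: "nat \<Rightarrow> (nat \<Rightarrow> real) set" where
  "nuisance_space p = {1..<p} \<rightarrow>\<^sub>E UNIV"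

abbreviation borel_vec :: "nat \<Rightarrow> (nat \<Rightarrow> real) measure" where
  "borel_vec p \<equiv> (\<Pi>\<^sub>M j\<in>{..<p}. borel)"

definition std_gaussian_vec :: "nat \<Rightarrow> (nat \<Rightarrow> real) measure" where
  "std_gaussian_vec p = (\<Pi>\<^sub>M j\<in>{..<p}. std_normal_distribution)"

definition loglik :: "nat \<Rightarrow> nat \<Rightarrow> (nat \<Rightarrow> nat \<Rightarrow> real) \<Rightarrow> real \<Rightarrow> (nat \<Rightarrow> real) \<Rightarrow> real" where
  "loglik p n y \<theta> \<eta> =
     - (1/2) * (\<Sum>i=1..n. (L2_set (\<lambda>j. y i j - model_map p \<theta> \<eta> j) {..<p})\<^sup>2)"

text \<open>The supremum is over a nonempty set bounded above by \<open>0\<close>, and it is attained: for \<open>n \<ge> 1\<close>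
  the log-likelihood is continuous in \<open>\<eta>\<close> and tends to minus infinity with the norm of \<open>\<eta>\<close>.\<close>

definition profile_loglik :: "nat \<Rightarrow> nat \<Rightarrow> (nat \<Rightarrow> nat \<Rightarrow> real) \<Rightarrow> real \<Rightarrow> real" where
  "profile_loglik p n y \<theta> = (SUP \<eta>\<in>nuisance_space p. loglik p n y \<theta> \<eta>)"

text \<open>For \<open>n \<ge> 1\<close> and \<open>p \<ge> 1\<close> the maximizer exists and is unique, because \<open>model_map p\<close> is a
  bijection between the parameter space and p-dimensional space.\<close>

definition profile_MLE :: "nat \<Rightarrow> nat \<Rightarrow> (nat \<Rightarrow> nat \<Rightarrow> real) \<Rightarrow> real" where
  "profile_MLE p n y = arg_max (profile_loglik p n y) (\<lambda>_. True)"

definition tendsto_zero_in_prob :: "'a measure \<Rightarrow> (nat \<Rightarrow> 'a \<Rightarrow> real) \<Rightarrow> bool" where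
  "tendsto_zero_in_prob M X \<longleftrightarrow>
     (\<forall>e>0. (\<lambda>n. measure M {\<omega> \<in> space M. \<bar>X n \<omega>\<bar> > e}) \<longlonglongrightarrow> 0)"

definition chi_square_1 :: "real measure" where
  "chi_square_1 = distr std_normal_distribution borel (\<lambda>x. x\<^sup>2)"

definition root_n_error_law ::
    "'a measure \<Rightarrow> (nat \<Rightarrow> 'a \<Rightarrow> real) \<Rightarrow> real \<Rightarrow> nat \<Rightarrow> real measure" where
  "root_n_error_law M T \<theta>\<^sub>0 n = distr M borel (\<lambda>\<omega>. sqrt (real n) * (T n \<omega> - \<theta>\<^sub>0))"

text \<open>
  Root-n consistency is used in the sense that leaves no bias at the root-n scale: the scaled
  error is bounded in probability and every limit law along a subsequence is centred.
  Boundedness in probability (tightness) alone does not see a bias of exact order \<open>1 / sqrt n\<close>,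
  which is what the quadratic model produces when the dimension is of order \<open>sqrt n\<close>.
  No limit law is prescribed and the full sequence need not converge.
\<close>

definition root_n_consistent :: "'a measure \<Rightarrow> (nat \<Rightarrow> 'a \<Rightarrow> real) \<Rightarrow> real \<Rightarrow> bool" where
  "root_n_consistent M T \<theta>\<^sub>0 \<longleftrightarrow>
     tight (root_n_error_law M T \<theta>\<^sub>0) \<and>
     (\<forall>r \<nu>. strict_mono (r :: nat \<Rightarrow> nat) \<longrightarrow> real_distribution \<nu> \<longrightarrow>
        weak_conv_m (root_n_error_law M T \<theta>\<^sub>0 \<circ> r) \<nu> \<longrightarrow>
        has_bochner_integral \<nu> (\<lambda>x. x) 0)"

end

theory Submission
  imports Defs
begin

text \<open>
  Writing \<open>z\<close> for the mean of the noise vectors, the log-likelihood is a constant minus \<open>n / 2\<close> times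
  the squared distance of \<open>z\<close> to the image of \<open>(\<theta>, \<eta>)\<close>, so \<open>\<theta>_hat = z\<^sub>0 - s\<^sup>2\<close>, where \<open>s\<close> is the norm of
  \<open>(z\<^sub>1, ..., z\<^bsub>p-1\<^esub>)\<close>, and the error of the Fisher expansion is exactly \<open>- V\<close> with \<open>V = sqrt n * s\<^sup>2\<close>.
  Here \<open>sqrt n * V\<close> is chi-square distributed with \<open>p - 1\<close> degrees of freedom: Chebyshev's
  inequality puts \<open>V\<close> within \<open>o(1)\<close> of \<open>p / sqrt n\<close> when this ratio stays bounded, and the exponential
  lower tail bound makes \<open>V\<close> diverge (almost surely, by Borel--Cantelli) when it does not.

  The Wilks statistic is \<open>n\<close> times the minimum over \<open>\<eta>\<close> of the squared distance at \<open>\<theta> = 0\<close>.  The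
  choice \<open>\<eta> = (z\<^sub>1, ..., z\<^bsub>p-1\<^esub>)\<close> gives the upper bound \<open>(\<xi> - V)\<^sup>2\<close>, which is asymptotically sharp for
  bounded \<open>V\<close>.  Along a subsequence with \<open>p / sqrt n \<longlonglongrightarrow> \<kappa>\<close> the limit laws of the root-n error and of the
  Wilks statistic are therefore those of \<open>Z - \<kappa>\<close> and \<open>(Z - \<kappa>)\<^sup>2\<close> for a standard normal \<open>Z\<close>, with means
  \<open>- \<kappa>\<close> and \<open>1 + \<kappa>\<^sup>2\<close>.
\<close>

section \<open>The profile likelihood\<close>

text \<open>For \<open>p \<ge> 1\<close> this is the squared Euclidean distance from
  \<open>z\<close> to \<open>model_map p \<theta> \<eta>\<close> over the coordinates below
  \<open>p\<close>, split into coordinate 0 and the nuisance part.\<close>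

definition misfit :: "nat \<Rightarrow> (nat \<Rightarrow> real) \<Rightarrow> real \<Rightarrow> (nat \<Rightarrow> real) \<Rightarrow> real" where
  "misfit p z \<theta> \<eta> = (z 0 - \<theta> - (L2_set \<eta> {1..<p})\<^sup>2)\<^sup>2 + (L2_set (\<lambda>j. z j - \<eta> j) {1..<p})\<^sup>2"

definition min_misfit :: "nat \<Rightarrow> (nat \<Rightarrow> real) \<Rightarrow> real \<Rightarrow> real" where
  "min_misfit p z \<theta> = (INF \<eta>\<in>nuisance_space p. misfit p z \<theta> \<eta>)"

lemma nuisance_space_nonempty: "nuisance_space p \<noteq> {}"
  by (auto simp: nuisance_space_def PiE_eq_empty_iff)

lemma misfit_nonneg: "0 \<le> misfit p z \<theta> \<eta>"
  by (simp add: misfit_def)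

lemma bdd_below_misfit: "bdd_below (misfit p z \<theta> ` A)"
  using misfit_nonneg by (auto intro!: bdd_belowI)

lemma min_misfit_le: "\<eta> \<in> nuisance_space p \<Longrightarrow> min_misfit p z \<theta> \<le> misfit p z \<theta> \<eta>"
  unfolding min_misfit_def by (intro cINF_lower bdd_below_misfit)

lemma min_misfit_greatest: "(\<And>\<eta>. c \<le> misfit p z \<theta> \<eta>) \<Longrightarrow> c \<le> min_misfit p z \<theta>"
  unfolding min_misfit_def by (intro cINF_greatest nuisance_space_nonempty)

lemma min_misfit_nonneg: "0 \<le> min_misfit p z \<theta>"
  by (intro min_misfit_greatest misfit_nonneg)

lemma sum_lessThan_head: "1 \<le> p \<Longrightarrow> (\<Sum>j<p. f j) = f 0 + (\<Sum>j=1..<p. f j)"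
  for f :: "nat \<Rightarrow> 'a::comm_monoid_add"
  by (metis lessThan_atLeast0 sum.atLeast_Suc_lessThan One_nat_def Suc_le_eq)

text \<open>The deviations from the mean sum to zero, which removes the cross term of the expansion
  around \<open>m\<close>.\<close>

lemma sum_sq_dev:
  fixes y :: "'i \<Rightarrow> real" and a m :: real
  assumes "finite I" "I \<noteq> {}"
  defines "m \<equiv> (\<Sum>i\<in>I. y i) / real (card I)"
  shows "(\<Sum>i\<in>I. (y i - a)\<^sup>2) = (\<Sum>i\<in>I. (y i - m)\<^sup>2) + card I * (m - a)\<^sup>2"
proof -
  have c: "real (card I) \<noteq> 0" using assms by simp
  have s: "(\<Sum>i\<in>I. y i) = card I * m" using c by (simp add: m_def)
  have "(\<Sum>i\<in>I. (y i - a)\<^sup>2) = (\<Sum>i\<in>I. (y i - m)\<^sup>2 + 2 * (m - a) * (y i - m) + (m - a)\<^sup>2)"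
    by (intro sum.cong refl) (simp add: power2_eq_square algebra_simps)
  also have "\<dots> = (\<Sum>i\<in>I. (y i - m)\<^sup>2) + 2 * (m - a) * (\<Sum>i\<in>I. y i - m) + card I * (m - a)\<^sup>2"
    by (simp add: sum.distrib sum_distrib_left)
  also have "(\<Sum>i\<in>I. y i - m) = 0" by (simp add: sum_subtractf s)
  finally show ?thesis by simp
qed

definition sample_mean :: "nat \<Rightarrow> (nat \<Rightarrow> nat \<Rightarrow> real) \<Rightarrow> nat \<Rightarrow> real" where
  "sample_mean n y j = (\<Sum>i=1..n. y i j) / real n"

definition max_loglik :: "nat \<Rightarrow> nat \<Rightarrow> (nat \<Rightarrow> nat \<Rightarrow> real) \<Rightarrow> real" where
  "max_loglik p n y = - (1/2) * (\<Sum>i=1..n. \<Sum>j<p. (y i j - sample_mean n y j)\<^sup>2)"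

text \<open>After the two sums are exchanged, \<open>sum_sq_dev\<close> applies in every coordinate,
  and the parameters meet the data only through the sample mean.\<close>

lemma loglik_eq_misfit:
  assumes "1 \<le> n" "1 \<le> p"
  shows "loglik p n y \<theta> \<eta> = max_loglik p n y - real n / 2 * misfit p (sample_mean n y) \<theta> \<eta>"
proof -
  let ?z = "sample_mean n y" and ?f = "model_map p \<theta> \<eta>"
  have "(\<Sum>i=1..n. (L2_set (\<lambda>j. y i j - ?f j) {..<p})\<^sup>2) = (\<Sum>i=1..n. \<Sum>j<p. (y i j - ?f j)\<^sup>2)"
    by (simp add: L2_set_def sum_nonneg)
  also have "\<dots> = (\<Sum>j<p. \<Sum>i=1..n. (y i j - ?f j)\<^sup>2)" by (rule sum.swap)
  also have "\<dots> = (\<Sum>j<p. (\<Sum>i=1..n. (y i j - ?z j)\<^sup>2) + real n * (?z j - ?f j)\<^sup>2)"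
    using sum_sq_dev[of "{1..n}" "\<lambda>i. y i j" "?f j" for j] assms by (simp add: sample_mean_def)
  also have "\<dots> = (\<Sum>i=1..n. \<Sum>j<p. (y i j - ?z j)\<^sup>2) + real n * (\<Sum>j<p. (?z j - ?f j)\<^sup>2)"
    by (subst sum.swap) (simp add: sum.distrib sum_distrib_left)
  also have "(\<Sum>j<p. (?z j - ?f j)\<^sup>2) = misfit p ?z \<theta> \<eta>"
    unfolding sum_lessThan_head[OF assms(2)]
    by (simp add: misfit_def L2_set_def sum_nonneg model_map_def algebra_simps)
  finally show ?thesis by (simp add: loglik_def max_loglik_def algebra_simps)
qed

lemma profile_loglik_eq_min_misfit:
  assumes "1 \<le> n" "1 \<le> p"
  shows "profile_loglik p n y \<theta> = max_loglik p n y - real n / 2 * min_misfit p (sample_mean n y) \<theta>"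
proof -
  let ?z = "sample_mean n y" and ?C = "max_loglik p n y"
  have n: "real n > 0" using assms by simp
  have bdd: "bdd_above ((\<lambda>\<eta>. ?C - real n / 2 * misfit p ?z \<theta> \<eta>) ` nuisance_space p)"
    by (intro bdd_aboveI[of _ ?C]) (auto simp: misfit_nonneg)
  have "(SUP \<eta>\<in>nuisance_space p. ?C - real n / 2 * misfit p ?z \<theta> \<eta>)
      = ?C - real n / 2 * min_misfit p ?z \<theta>" (is "?S = _")
  proof (rule antisym)
    show "?S \<le> ?C - real n / 2 * min_misfit p ?z \<theta>"
      using n by (intro cSUP_least nuisance_space_nonempty diff_left_mono mult_left_mono min_misfit_le) auto
    \<comment> \<open>The inequality is solved for the infimum, so that it can be checked for each
      \<open>\<eta>\<close> separately.\<close>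
    have "(?C - ?S) * 2 / real n \<le> min_misfit p ?z \<theta>"
      unfolding min_misfit_def
    proof (intro cINF_greatest nuisance_space_nonempty)
      fix \<eta> assume "\<eta> \<in> nuisance_space p"
      then have "?C - real n / 2 * misfit p ?z \<theta> \<eta> \<le> ?S" by (intro cSUP_upper bdd)
      then show "(?C - ?S) * 2 / real n \<le> misfit p ?z \<theta> \<eta>" using n by (simp add: field_simps)
    qed
    then show "?C - real n / 2 * min_misfit p ?z \<theta> \<le> ?S" using n by (simp add: field_simps)
  qed
  then show ?thesis by (simp add: profile_loglik_def loglik_eq_misfit[OF assms])
qed

section \<open>Bounds for the minimal misfit and the form of the profile MLE\<close>

lemma L2_set_diff_le:
  assumes "finite A"
  shows "\<bar>L2_set f A - L2_set g A\<bar> \<le> L2_set (\<lambda>j. f j - g j) A"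
proof -
  have "L2_set f A \<le> L2_set (\<lambda>j. f j - g j) A + L2_set g A"
    using L2_set_triangle_ineq[of "\<lambda>j. f j - g j" g A] by simp
  moreover have "L2_set g A \<le> L2_set (\<lambda>j. f j - g j) A + L2_set f A"
    using L2_set_triangle_ineq[of "\<lambda>j. g j - f j" f A]
    by (simp add: L2_set_def power2_commute)
  ultimately show ?thesis by linarith
qed

text \<open>By the reverse triangle inequality, this bound depends on \<open>\<eta>\<close> only
  through its norm, which reduces all lower bounds to a problem in one real variable
  \<open>r\<close>.\<close>

lemma misfit_ge:
  "(z 0 - \<theta> - (L2_set \<eta> {1..<p})\<^sup>2)\<^sup>2 + (L2_set z {1..<p} - L2_set \<eta> {1..<p})\<^sup>2 \<le> misfit p z \<theta> \<eta>"
  unfolding misfit_def using L2_set_diff_le[of "{1..<p}" z \<eta>]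
  by (intro add_left_mono) (simp add: abs_le_square_iff[symmetric] L2_set_nonneg)

text \<open>The nuisance part of \<open>z\<close> itself serves as \<open>\<eta>\<close> and makes
  the second square vanish. It is restricted because \<open>nuisance_space\<close> consists of
  extensional functions.\<close>

lemma min_misfit_le_sq: "min_misfit p z \<theta> \<le> (z 0 - \<theta> - (L2_set z {1..<p})\<^sup>2)\<^sup>2"
proof -
  let ?z = "restrict z {1..<p}"
  have "?z \<in> nuisance_space p" by (auto simp: nuisance_space_def)
  from min_misfit_le[OF this] have "min_misfit p z \<theta> \<le> misfit p z \<theta> ?z" .
  also have "\<dots> = (z 0 - \<theta> - (L2_set z {1..<p})\<^sup>2)\<^sup>2" by (simp add: misfit_def L2_set_def)
  finally show ?thesis .
qed

text \<open>An optimal \<open>\<eta>\<close> has a norm within \<open>q\<close> of \<open>s\<close>, so replacing its norm by \<open>s\<close> changes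
  the first residual by at most \<open>q * (2 * s + q)\<close>.\<close>
lemma min_misfit_ge_sq:
  fixes p z \<theta>
  defines "s \<equiv> L2_set z {1..<p}"
  defines "q \<equiv> \<bar>z 0 - \<theta> - s\<^sup>2\<bar>"
  shows "q\<^sup>2 * (1 - 2 * (2 * s + q)) \<le> min_misfit p z \<theta>"
proof (rule min_misfit_greatest)
  fix \<eta>
  define r where "r = L2_set \<eta> {1..<p}"
  have s: "0 \<le> s" and r: "0 \<le> r" and q: "0 \<le> q" by (simp_all add: s_def r_def q_def L2_set_nonneg)
  let ?u = "2 * s + q"
  have "q\<^sup>2 * (1 - 2 * ?u) \<le> (z 0 - \<theta> - r\<^sup>2)\<^sup>2 + (s - r)\<^sup>2"
  \<comment> \<open>If the norms differ by at least \<open>q\<close>, the second square alone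
    reaches \<open>q^2\<close>. Otherwise the first residual is at least
    \<open>q * (1 - ?u)\<close>, and \<open>(1 - ?u)^2 \<ge> 1 - 2 * ?u\<close>; for
    \<open>?u > 1\<close> the claimed bound is nonpositive.\<close>
  proof (cases "q \<le> \<bar>s - r\<bar>")
    case True
    then have "q\<^sup>2 \<le> (s - r)\<^sup>2" using q by (simp add: abs_le_square_iff[symmetric])
    moreover have "q\<^sup>2 * (1 - 2 * ?u) \<le> q\<^sup>2 * 1" using s q by (intro mult_left_mono) auto
    moreover have "0 \<le> (z 0 - \<theta> - r\<^sup>2)\<^sup>2" by simp
    ultimately show ?thesis by linarith
  next
    case False
    have "\<bar>s\<^sup>2 - r\<^sup>2\<bar> = \<bar>s - r\<bar> * \<bar>s + r\<bar>"
      by (simp add: abs_mult[symmetric] power2_eq_square algebra_simps)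
    also have "\<dots> \<le> q * ?u" using False s r q by (intro mult_mono) auto
    finally have a: "\<bar>s\<^sup>2 - r\<^sup>2\<bar> \<le> q * ?u" .
    show ?thesis
    proof (cases "?u \<le> 1")
      case True
      have "q * (1 - ?u) \<le> \<bar>z 0 - \<theta> - r\<^sup>2\<bar>"
        using a unfolding q_def by (simp add: algebra_simps)
      moreover have "0 \<le> q * (1 - ?u)" using True q by simp
      ultimately have "(q * (1 - ?u))\<^sup>2 \<le> (z 0 - \<theta> - r\<^sup>2)\<^sup>2"
        by (metis abs_le_square_iff abs_of_nonneg abs_abs)
      moreover have "q\<^sup>2 * (1 - 2 * ?u) \<le> q\<^sup>2 * (1 - ?u)\<^sup>2"
        using zero_le_power2[of ?u] by (intro mult_left_mono) (simp_all add: power2_diff)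
      ultimately show ?thesis by (simp add: power_mult_distrib add_increasing2)
    next
      case F: False
      have "q\<^sup>2 * (1 - 2 * ?u) \<le> 0" using F by (intro mult_nonneg_nonpos) auto
      then show ?thesis by (smt (verit) zero_le_power2)
    qed
  qed
  also have "\<dots> \<le> misfit p z \<theta> \<eta>" unfolding s_def r_def by (rule misfit_ge)
  finally show "q\<^sup>2 * (1 - 2 * ?u) \<le> misfit p z \<theta> \<eta>" .
qed

text \<open>Positivity for each \<open>\<eta>\<close> would not suffice for an infimum, so a uniform
  bound is derived: either \<open>r\<close> is at least \<open>\<tau>\<close> away from
  \<open>s\<close>, or \<open>r^2\<close> is so close to \<open>s^2\<close> that the first residual
  keeps half of its size \<open>d\<close>.\<close>

lemma min_misfit_pos:
  assumes "\<theta> \<noteq> z 0 - (L2_set z {1..<p})\<^sup>2"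
  shows "0 < min_misfit p z \<theta>"
proof -
  define s where "s = L2_set z {1..<p}"
  define d where "d = \<bar>z 0 - \<theta> - s\<^sup>2\<bar>"
  \<comment> \<open>The cap 1 gives \<open>r + s \<le> 2 * s + 1\<close> when
    \<open>\<bar>s - r\<bar> < \<tau>\<close>; the other bound then keeps
    \<open>\<bar>s\<^sup>2 - r\<^sup>2\<bar>\<close> below \<open>d / 2\<close>.\<close>
  define \<tau> where "\<tau> = min 1 (d / (2 * (2 * s + 1)))"
  have s: "0 \<le> s" by (simp add: s_def L2_set_nonneg)
  have d: "0 < d" using assms by (auto simp: d_def s_def)
  have \<tau>: "0 < \<tau>" "\<tau> \<le> 1" using s d by (auto simp: \<tau>_def)
  have "\<tau> \<le> d / 2 / (2 * s + 1)" by (simp add: \<tau>_def)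
  then have \<tau>d: "\<tau> * (2 * s + 1) \<le> d / 2" using s by (subst (asm) pos_le_divide_eq) auto
  have "min (\<tau>\<^sup>2) ((d/2)\<^sup>2) \<le> min_misfit p z \<theta>"
  proof (rule min_misfit_greatest)
    fix \<eta>
    define r where "r = L2_set \<eta> {1..<p}"
    have r: "0 \<le> r" by (simp add: r_def L2_set_nonneg)
    have "min (\<tau>\<^sup>2) ((d/2)\<^sup>2) \<le> (z 0 - \<theta> - r\<^sup>2)\<^sup>2 + (s - r)\<^sup>2"
    proof (cases "\<tau> \<le> \<bar>s - r\<bar>")
      case True
      then have "\<tau>\<^sup>2 \<le> (s - r)\<^sup>2" using \<tau> by (simp add: abs_le_square_iff[symmetric])
      then show ?thesis by (smt (verit) zero_le_power2)
    next
      case False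
      have "\<bar>s\<^sup>2 - r\<^sup>2\<bar> = \<bar>s - r\<bar> * \<bar>s + r\<bar>"
        by (simp add: abs_mult[symmetric] power2_eq_square algebra_simps)
      also have "\<dots> \<le> \<tau> * (2 * s + 1)" using False s r \<tau> by (intro mult_mono) auto
      finally have a: "\<bar>s\<^sup>2 - r\<^sup>2\<bar> \<le> \<tau> * (2 * s + 1)" .
      have "d \<le> \<bar>z 0 - \<theta> - r\<^sup>2\<bar> + \<bar>s\<^sup>2 - r\<^sup>2\<bar>" unfolding d_def by linarith
      then have "d / 2 \<le> \<bar>z 0 - \<theta> - r\<^sup>2\<bar>" using a \<tau>d by linarith
      then have "(d / 2)\<^sup>2 \<le> (z 0 - \<theta> - r\<^sup>2)\<^sup>2" using d by (simp add: abs_le_square_iff[symmetric])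
      then show ?thesis by (smt (verit) zero_le_power2)
    qed
    also have "\<dots> \<le> misfit p z \<theta> \<eta>" unfolding s_def r_def by (rule misfit_ge)
    finally show "min (\<tau>\<^sup>2) ((d/2)\<^sup>2) \<le> misfit p z \<theta> \<eta>" .
  qed
  moreover have "0 < min (\<tau>\<^sup>2) ((d/2)\<^sup>2)" using \<tau> d by simp
  ultimately show ?thesis by linarith
qed

lemma min_misfit_eq_0_iff: "min_misfit p z \<theta> = 0 \<longleftrightarrow> \<theta> = z 0 - (L2_set z {1..<p})\<^sup>2"
  using min_misfit_pos[of \<theta> z p] min_misfit_le_sq[of p z \<theta>] min_misfit_nonneg[of p z \<theta>] by force

text \<open>The minimal misfit is nonnegative and vanishes at exactly one \<open>\<theta>\<close>,
  so the choice made by \<open>arg_max\<close> is forced.\<close>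

lemma profile_MLE_eq:
  fixes n p y
  assumes "1 \<le> n" "1 \<le> p"
  defines "z \<equiv> sample_mean n y"
  shows "profile_MLE p n y = z 0 - (L2_set z {1..<p})\<^sup>2"
proof -
  let ?L = "profile_loglik p n y" and ?k = "z 0 - (L2_set z {1..<p})\<^sup>2"
  note L = profile_loglik_eq_min_misfit[OF assms(1,2), of y, folded z_def]
  have "?L (arg_max ?L (\<lambda>_. True)) = ?L ?k"
    using min_misfit_nonneg[of p z] min_misfit_eq_0_iff[of p z ?k]
    by (intro arg_max_equality) (auto simp: L)
  then have "min_misfit p z (profile_MLE p n y) = 0"
    using assms min_misfit_eq_0_iff[of p z ?k] by (simp add: L profile_MLE_def)
  then show ?thesis by (simp add: min_misfit_eq_0_iff)
qed

text \<open>The data term \<open>max_loglik\<close> cancels, and the minimal misfit vanishes at the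
  maximizer.\<close>

lemma wilks_stat_eq:
  assumes "1 \<le> n" "1 \<le> p"
  shows "2 * (profile_loglik p n y (profile_MLE p n y) - profile_loglik p n y \<theta>)
       = real n * min_misfit p (sample_mean n y) \<theta>"
  using min_misfit_eq_0_iff[of p "sample_mean n y" "profile_MLE p n y"]
  by (simp add: profile_loglik_eq_min_misfit[OF assms] profile_MLE_eq[OF assms] algebra_simps)

text \<open>An infimum lies below \<open>c\<close> exactly when some member does, so the set is a
  union of open sets, one for each \<open>\<eta>\<close>.\<close>

lemma open_min_misfit_less: "open {z. min_misfit p z \<theta> < c}"
proof -
  have eq: "{z. min_misfit p z \<theta> < c} = (\<Union>\<eta>\<in>nuisance_space p. {z. misfit p z \<theta> \<eta> < c})"
    by (auto simp: min_misfit_def cINF_less_iff[OF nuisance_space_nonempty bdd_below_misfit])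
  have "open {z. misfit p z \<theta> \<eta> < c}" for \<eta>
    unfolding misfit_def L2_set_def
    by (intro open_Collect_less continuous_intros continuous_on_product_coordinates)
  then show ?thesis unfolding eq by blast
qed

text \<open>The infimum is over an uncountable set; it is measurable because it is upper semicontinuous
  in the product topology on \<open>nat \<Rightarrow> real\<close>.\<close>
lemma borel_measurable_min_misfit:
  assumes "\<And>j. (\<lambda>\<omega>. z \<omega> j) \<in> borel_measurable M"
  shows "(\<lambda>\<omega>. min_misfit p (z \<omega>) \<theta>) \<in> borel_measurable M"
proof -
  have "z \<in> borel_measurable M" by (rule measurable_coordinatewise_then_product) (rule assms)
  moreover have "(\<lambda>z. min_misfit p z \<theta>) \<in> borel_measurable borel"
    unfolding borel_measurable_iff_less using open_min_misfit_less[of p \<theta>] by auto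
  ultimately show ?thesis by (rule measurable_compose)
qed

lemma min_misfit_cong:
  "(\<And>j. j < p \<Longrightarrow> z j = z' j) \<Longrightarrow> 1 \<le> p \<Longrightarrow> min_misfit p z \<theta> = min_misfit p z' \<theta>"
  by (simp add: min_misfit_def misfit_def L2_set_def)

text \<open>Serves the case of a large bias, where \<open>min_misfit_ge_sq\<close> may be void. A
  norm \<open>r \<le> s / 2\<close> costs \<open>(s / 2)^2\<close> in the second square; a larger
  one pushes the first residual beyond \<open>s^2 / 4 - (z 0 - \<theta>)\<close>.\<close>

lemma min_misfit_ge_min:
  fixes p z \<theta>
  defines "s \<equiv> L2_set z {1..<p}"
  assumes "z 0 - \<theta> \<le> s\<^sup>2 / 4"
  shows "min (s\<^sup>2 / 4) ((s\<^sup>2 / 4 - (z 0 - \<theta>))\<^sup>2) \<le> min_misfit p z \<theta>"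
proof (rule min_misfit_greatest)
  fix \<eta>
  define r where "r = L2_set \<eta> {1..<p}"
  have s: "0 \<le> s" and r: "0 \<le> r" by (simp_all add: s_def r_def L2_set_nonneg)
  have "min (s\<^sup>2 / 4) ((s\<^sup>2 / 4 - (z 0 - \<theta>))\<^sup>2) \<le> (z 0 - \<theta> - r\<^sup>2)\<^sup>2 + (s - r)\<^sup>2"
  proof (cases "r \<le> s / 2")
    case True
    then have "(s/2)\<^sup>2 \<le> (s - r)\<^sup>2" using s by (intro power_mono) auto
    then show ?thesis by (simp add: power_divide min_le_iff_disj add_increasing)
  next
    case False
    then have "(s/2)\<^sup>2 \<le> r\<^sup>2" using s by (intro power_mono) auto
    then have "(s\<^sup>2 / 4 - (z 0 - \<theta>))\<^sup>2 \<le> (r\<^sup>2 - (z 0 - \<theta>))\<^sup>2" using assms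
      by (intro power_mono) (auto simp: power_divide)
    then show ?thesis
      by (simp add: power2_commute[of "r\<^sup>2"] min_le_iff_disj add_increasing2)
  qed
  also have "\<dots> \<le> misfit p z \<theta> \<eta>" unfolding s_def r_def by (rule misfit_ge)
  finally show "min (s\<^sup>2 / 4) ((s\<^sup>2 / 4 - (z 0 - \<theta>))\<^sup>2) \<le> misfit p z \<theta> \<eta>" .
qed

section \<open>Limit theorems and Gaussian tail bounds\<close>

lemma (in prob_space) iexp_integral_diff_le:
  assumes [measurable]: "X \<in> borel_measurable M" "Z \<in> borel_measurable M" and "0 \<le> e"
  shows "cmod ((\<integral>\<omega>. iexp (t * X \<omega>) \<partial>M) - (\<integral>\<omega>. iexp (t * Z \<omega>) \<partial>M))
       \<le> \<bar>t\<bar> * e + 2 * prob {\<omega>\<in>space M. e < \<bar>X \<omega> - Z \<omega>\<bar>}"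
proof -
  let ?B = "{\<omega>\<in>space M. e < \<bar>X \<omega> - Z \<omega>\<bar>}"
  have int: "integrable M (\<lambda>\<omega>. iexp (t * f \<omega>))" if "f \<in> borel_measurable M" for f
    using that by (intro integrable_iexp) auto
  \<comment> \<open>The map \<open>x \<mapsto> iexp (t * x)\<close> is Lipschitz with constant
    \<open>\<bar>t\<bar>\<close> and has modulus 1. The first fact is used where the arguments are
    within \<open>e\<close>, the second elsewhere.\<close>
  have bnd: "cmod (iexp (t * x) - iexp (t * z)) \<le> \<bar>t\<bar> * e + (if e < \<bar>x - z\<bar> then 2 else 0)" for x z
  proof -
    have "cmod (iexp (t * x) - iexp (t * z)) \<le> 2"
      by (rule order_trans[OF norm_triangle_ineq4]) simp
    moreover have "cmod (iexp (t * x) - iexp (t * z)) \<le> \<bar>t\<bar> * \<bar>x - z\<bar>"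
    proof -
      have "iexp (t * x) - iexp (t * z) = iexp (t * z) * (iexp (t * (x - z)) - 1)"
        by (simp add: algebra_simps flip: exp_add)
      then have "cmod (iexp (t * x) - iexp (t * z)) = cmod (iexp (t * (x - z)) - 1)"
        by (simp add: norm_mult)
      also have "\<dots> \<le> \<bar>t * (x - z)\<bar>" using iexp_approx1[of "t * (x - z)" 0] by simp
      finally show ?thesis by (simp add: abs_mult)
    qed
    moreover have "\<bar>t\<bar> * \<bar>x - z\<bar> \<le> \<bar>t\<bar> * e" if "\<not> e < \<bar>x - z\<bar>"
      using that by (intro mult_left_mono) auto
    moreover have "0 \<le> \<bar>t\<bar> * e" using assms by simp
    ultimately show ?thesis by (cases "e < \<bar>x - z\<bar>") auto
  qed
  have ind: "integrable M (\<lambda>\<omega>. \<bar>t\<bar> * e + 2 * indicat_real ?B \<omega>)"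
    by (intro Bochner_Integration.integrable_add integrable_mult_right integrable_real_indicator)
       (auto simp: emeasure_eq_measure)
  have "cmod ((\<integral>\<omega>. iexp (t * X \<omega>) \<partial>M) - (\<integral>\<omega>. iexp (t * Z \<omega>) \<partial>M))
      = cmod (\<integral>\<omega>. iexp (t * X \<omega>) - iexp (t * Z \<omega>) \<partial>M)"
    using int[of X] int[of Z] by (subst Bochner_Integration.integral_diff) auto
  also have "\<dots> \<le> (\<integral>\<omega>. \<bar>t\<bar> * e + 2 * indicat_real ?B \<omega> \<partial>M)"
  proof (rule order_trans[OF integral_norm_bound integral_mono[OF _ ind]])
    show "integrable M (\<lambda>\<omega>. cmod (iexp (t * X \<omega>) - iexp (t * Z \<omega>)))"
      using int[of X] int[of Z] by auto
    show "cmod (iexp (t * X \<omega>) - iexp (t * Z \<omega>)) \<le> \<bar>t\<bar> * e + 2 * indicat_real ?B \<omega>"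
      if "\<omega> \<in> space M" for \<omega>
      using bnd[of "X \<omega>" "Z \<omega>"] that by (auto simp: indicator_def)
  qed
  also have "\<dots> = \<bar>t\<bar> * e + 2 * prob ?B"
    by (subst Bochner_Integration.integral_add) (auto simp: prob_space emeasure_eq_measure)
  finally show ?thesis .
qed

text \<open>A form of Slutsky's theorem: the characteristic functions of \<open>X n\<close> and
  \<open>Z n\<close> approach each other, that of \<open>Z n\<close> is constant in
  \<open>n\<close>, and Levy's continuity theorem concludes.\<close>

lemma (in prob_space) weak_conv_m_if_diff_tendsto_zero:
  assumes [measurable]: "\<And>n. X n \<in> borel_measurable M" "\<And>n. Z n \<in> borel_measurable M"
    and law: "\<And>n. distr M borel (Z n) = \<nu>"
    and diff: "tendsto_zero_in_prob M (\<lambda>n \<omega>. X n \<omega> - Z n \<omega>)"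
  shows "weak_conv_m (\<lambda>n. distr M borel (X n)) \<nu>"
proof (rule levy_continuity)
  show "real_distribution (distr M borel (X n))" for n by (rule real_distribution_distr) simp
  show "real_distribution \<nu>" unfolding law[of 0, symmetric] by (rule real_distribution_distr) simp
  fix t :: real
  have ch: "char (distr M borel f) t = (\<integral>\<omega>. iexp (t * f \<omega>) \<partial>M)" if "f \<in> borel_measurable M" for f
    using that by (simp add: char_def integral_distr)
  show "(\<lambda>n. char (distr M borel (X n)) t) \<longlonglongrightarrow> char \<nu> t"
  proof (rule metric_LIMSEQ_I)
    fix d :: real assume d: "0 < d"
    \<comment> \<open>One half of \<open>d\<close> is spent on \<open>\<bar>t\<bar> * e\<close>, the
      other on twice the probability; the added 1 covers \<open>t = 0\<close>.\<close>
    define e where "e = d / (2 * (\<bar>t\<bar> + 1))"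
    have e: "0 < e" using d by (simp add: e_def add_nonneg_pos)
    have "\<bar>t\<bar> * e \<le> (\<bar>t\<bar> + 1) * e" using e by (intro mult_right_mono) auto
    also have "\<dots> = d / 2" by (simp add: e_def field_simps)
    finally have te: "\<bar>t\<bar> * e \<le> d / 2" .
    let ?P = "\<lambda>n. prob {\<omega>\<in>space M. e < \<bar>X n \<omega> - Z n \<omega>\<bar>}"
    have "?P \<longlonglongrightarrow> 0" using diff e by (simp add: tendsto_zero_in_prob_def)
    then have "\<forall>\<^sub>F n in sequentially. ?P n < d / 4" using d by (intro order_tendstoD(2)) auto
    then obtain N where N: "\<And>n. n \<ge> N \<Longrightarrow> ?P n < d / 4" by (auto simp: eventually_sequentially)
    have "dist (char (distr M borel (X n)) t) (char \<nu> t) < d" if "n \<ge> N" for n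
      using iexp_integral_diff_le[of "X n" "Z n" e t] e te N[OF that]
      unfolding law[of n, symmetric] by (simp add: ch dist_norm)
    then show "\<exists>N. \<forall>n\<ge>N. dist (char (distr M borel (X n)) t) (char \<nu> t) < d" by blast
  qed
qed

section \<open>Moments and tails of chi-square sums\<close>

lemma (in prob_space) second_moment_sum_indep:
  fixes Y :: "'i \<Rightarrow> 'a \<Rightarrow> real" and v :: real
  assumes "finite J" "indep_vars (\<lambda>_. borel) Y J"
    and "\<And>j. j \<in> J \<Longrightarrow> integrable M (\<lambda>\<omega>. (Y j \<omega>)\<^sup>2)"
    and "\<And>j. j \<in> J \<Longrightarrow> expectation (Y j) = 0"
    and "\<And>j. j \<in> J \<Longrightarrow> expectation (\<lambda>\<omega>. (Y j \<omega>)\<^sup>2) = v"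
  shows "integrable M (\<lambda>\<omega>. (\<Sum>j\<in>J. Y j \<omega>)\<^sup>2) \<and> expectation (\<lambda>\<omega>. (\<Sum>j\<in>J. Y j \<omega>)\<^sup>2) = card J * v"
  using assms
proof (induction J)
  case empty
  then show ?case by simp
next
  case (insert i J)
  let ?S = "\<lambda>\<omega>. \<Sum>j\<in>J. Y j \<omega>"
  have J: "indep_vars (\<lambda>_. borel) Y J" using insert.prems(1) by (rule indep_vars_subset) auto
  have IH: "integrable M (\<lambda>\<omega>. (?S \<omega>)\<^sup>2)" "expectation (\<lambda>\<omega>. (?S \<omega>)\<^sup>2) = card J * v"
    using insert.IH[OF J] insert.prems by auto
  have rv: "j \<in> insert i J \<Longrightarrow> Y j \<in> borel_measurable M" for j
    using insert.prems(1) by (auto simp: indep_vars_def)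
  have int: "integrable M (Y j)" if "j \<in> insert i J" for j
    by (rule square_integrable_imp_integrable[OF rv[OF that] insert.prems(2)[OF that]])
  have S: "integrable M ?S" using int by auto
  \<comment> \<open>The new summand is independent of the sum of the others and centred, so the
    cross term has expectation zero and second moments add.\<close>
  have ind: "indep_var borel (Y i) borel ?S"
    using insert.hyps insert.prems(1) by (rule indep_vars_sum)
  have cross: "integrable M (\<lambda>\<omega>. Y i \<omega> * ?S \<omega>)" "expectation (\<lambda>\<omega>. Y i \<omega> * ?S \<omega>) = 0"
    using indep_var_integrable[OF ind] indep_var_lebesgue_integral[OF ind] int S insert.prems(3) by auto
  have sq: "(\<Sum>j\<in>insert i J. Y j \<omega>)\<^sup>2 = (Y i \<omega>)\<^sup>2 + 2 * (Y i \<omega> * ?S \<omega>) + (?S \<omega>)\<^sup>2" for \<omega>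
    using insert.hyps by (simp add: power2_sum)
  have "integrable M (\<lambda>\<omega>. (Y i \<omega>)\<^sup>2)" "expectation (\<lambda>\<omega>. (Y i \<omega>)\<^sup>2) = v"
    using insert.prems(2,4) by auto
  then show ?case unfolding sq using IH cross insert.hyps by (simp add: algebra_simps)
qed

text \<open>Multiplying the standard normal density by \<open>exp (- x^2)\<close> gives
  \<open>1 / sqrt 3\<close> times the density of variance \<open>1 / 3\<close>. The value is the
  moment generating function of the chi-square law with one degree of freedom at
  \<open>- 1\<close>.\<close>

lemma std_normal_exp_neg_sq:
  "integrable std_normal_distribution (\<lambda>x. exp (- x\<^sup>2))"
  "(\<integral>x. exp (- x\<^sup>2) \<partial>std_normal_distribution) = 1 / sqrt 3"
proof -
  have eq: "std_normal_density x * exp (- x\<^sup>2) = 1 / sqrt 3 * normal_density 0 (1 / sqrt 3) x" for x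
    by (simp add: normal_density_def power_divide real_sqrt_divide real_sqrt_mult field_simps flip: exp_add)
  have "integrable lborel (\<lambda>x. std_normal_density x * exp (- x\<^sup>2))"
    unfolding eq by simp
  then show "integrable std_normal_distribution (\<lambda>x. exp (- x\<^sup>2))"
    by (subst integrable_density) (auto simp: normal_density_nonneg)
  have "(\<integral>x. exp (- x\<^sup>2) \<partial>std_normal_distribution) = (\<integral>x. std_normal_density x * exp (- x\<^sup>2) \<partial>lborel)"
    by (subst integral_density) (auto simp: normal_density_nonneg)
  also have "\<dots> = 1 / sqrt 3" unfolding eq by simp
  finally show "(\<integral>x. exp (- x\<^sup>2) \<partial>std_normal_distribution) = 1 / sqrt 3" .
qed

lemma std_normal_moments:
  "(\<integral>x. x\<^sup>2 \<partial>std_normal_distribution) = 1"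
  "(\<integral>x. x^4 \<partial>std_normal_distribution) = 3"
  using std_normal_distribution_even_moments(1)[of 1] std_normal_distribution_even_moments(1)[of 2]
  by (simp_all add: fact_numeral)

context prob_space
begin

context
  fixes G :: "'i \<Rightarrow> 'a \<Rightarrow> real" and J :: "'i set"
  assumes J: "finite J" and indep: "indep_vars (\<lambda>_. borel) G J"
    and law: "\<And>j. j \<in> J \<Longrightarrow> distr M borel (G j) = std_normal_distribution"
begin

lemma std_normal_rv: "j \<in> J \<Longrightarrow> G j \<in> borel_measurable M"
  using indep by (auto simp: indep_vars_def)

lemma std_normal_transfer:
  fixes f :: "real \<Rightarrow> real"
  assumes "j \<in> J" "f \<in> borel_measurable borel"
  shows "expectation (\<lambda>\<omega>. f (G j \<omega>)) = (\<integral>x. f x \<partial>std_normal_distribution)"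
    and "integrable M (\<lambda>\<omega>. f (G j \<omega>)) \<longleftrightarrow> integrable std_normal_distribution f"
  unfolding law[OF assms(1), symmetric]
  using assms std_normal_rv by (simp_all add: integral_distr integrable_distr_eq)

text \<open>The centred squares \<open>(G j)^2 - 1\<close> are independent with second moment
  \<open>3 - 2 + 1 = 2\<close>, so their sum has variance \<open>2 * card J\<close>.\<close>

lemma chi_square_Chebyshev:
  assumes "0 < a"
  shows "prob {\<omega>\<in>space M. a \<le> \<bar>(\<Sum>j\<in>J. (G j \<omega>)\<^sup>2) - card J\<bar>} \<le> 2 * card J / a\<^sup>2"
proof -
  let ?Y = "\<lambda>j \<omega>. (G j \<omega>)\<^sup>2 - 1"
  let ?S = "\<lambda>\<omega>. \<Sum>j\<in>J. ?Y j \<omega>"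
  note [measurable] = std_normal_rv
  have sq: "(x\<^sup>2 - 1)\<^sup>2 = x^4 - 2 * x\<^sup>2 + 1" for x :: real
    by (simp add: power2_eq_square power4_eq_xxxx algebra_simps)
  note int = integrable_std_normal_distribution_moment
  interpret N: prob_space std_normal_distribution by (rule prob_space_normal_density) simp
  have Y0: "expectation (?Y j) = 0" if "j \<in> J" for j
    using that int[of 2] std_normal_moments N.prob_space by (subst std_normal_transfer) auto
  have Y2: "expectation (\<lambda>\<omega>. (?Y j \<omega>)\<^sup>2) = 2" if "j \<in> J" for j
    using that int[of 2] int[of 4] std_normal_moments N.prob_space
    by (subst std_normal_transfer) (auto simp: sq)
  have Yi: "integrable M (\<lambda>\<omega>. (?Y j \<omega>)\<^sup>2)" if "j \<in> J" for j
    using that int[of 2] int[of 4] by (subst std_normal_transfer) (auto simp: sq)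
  have ind: "indep_vars (\<lambda>_. borel) ?Y J"
    using indep_vars_compose2[OF indep, of "\<lambda>_ x. x\<^sup>2 - 1" "\<lambda>_. borel"] by simp
  have S: "integrable M (\<lambda>\<omega>. (?S \<omega>)\<^sup>2)" "expectation (\<lambda>\<omega>. (?S \<omega>)\<^sup>2) = card J * 2"
    using second_moment_sum_indep[OF J ind Yi Y0 Y2] by auto
  have "prob {\<omega>\<in>space M. a \<le> \<bar>?S \<omega>\<bar>} \<le> expectation (\<lambda>\<omega>. (?S \<omega>)\<^sup>2) / a\<^sup>2"
    using S(1) assms by (intro second_moment_method) auto
  then show ?thesis unfolding S(2) by (simp add: sum_subtractf mult.commute)
qed

text \<open>Markov's inequality for \<open>exp (- W)\<close>, with \<open>W\<close> the sum of
  squares: by independence the expectation is \<open>(1 / sqrt 3) ^ card J\<close>, and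
  \<open>1 / sqrt 3 \<le> exp (- 1 / 2)\<close> because Euler's number is at most 3.\<close>

lemma chi_square_lower_tail:
  "prob {\<omega>\<in>space M. (\<Sum>j\<in>J. (G j \<omega>)\<^sup>2) \<le> a} \<le> exp (a - card J / 2)"
proof -
  let ?W = "\<lambda>\<omega>. \<Sum>j\<in>J. (G j \<omega>)\<^sup>2"
  note [measurable] = std_normal_rv
  have ind: "indep_vars (\<lambda>_. borel) (\<lambda>j \<omega>. exp (- (G j \<omega>)\<^sup>2)) J"
    using indep_vars_compose2[OF indep, of "\<lambda>_ x. exp (- x\<^sup>2)" "\<lambda>_. borel"] by simp
  have i: "integrable M (\<lambda>\<omega>. exp (- (G j \<omega>)\<^sup>2))" if "j \<in> J" for j
    using that std_normal_exp_neg_sq by (subst std_normal_transfer(2)) auto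
  have e: "expectation (\<lambda>\<omega>. exp (- (G j \<omega>)\<^sup>2)) = 1 / sqrt 3" if "j \<in> J" for j
    using that std_normal_exp_neg_sq by (subst std_normal_transfer(1)) auto
  have eW: "exp (- ?W \<omega>) = (\<Prod>j\<in>J. exp (- (G j \<omega>)\<^sup>2))" for \<omega>
    using J by (simp add: exp_sum sum_negf[symmetric])
  have iW: "integrable M (\<lambda>\<omega>. exp (- ?W \<omega>))"
    unfolding eW using indep_vars_integrable[OF J ind i] .
  have EW: "expectation (\<lambda>\<omega>. exp (- ?W \<omega>)) = (1 / sqrt 3) ^ card J"
    unfolding eW using indep_vars_lebesgue_integral[OF J ind i] e by simp
  have "exp (1/2) \<le> sqrt 3"
    using exp_le by (intro real_le_rsqrt) (simp add: power2_eq_square flip: exp_add)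
  then have "1 / sqrt 3 \<le> exp (- (1/2))" by (simp add: exp_minus field_simps)
  then have "(1 / sqrt 3) ^ card J \<le> exp (- (1/2)) ^ card J" by (intro power_mono) auto
  also have "\<dots> = exp (- card J / 2)" by (simp flip: exp_of_nat_mult)
  finally have pw: "(1 / sqrt 3) ^ card J \<le> exp (- card J / 2)" .
  have "{\<omega>\<in>space M. ?W \<omega> \<le> a} = {\<omega>\<in>space M. exp (- a) \<le> exp (- ?W \<omega>)}" by auto
  then have "prob {\<omega>\<in>space M. ?W \<omega> \<le> a} \<le> expectation (\<lambda>\<omega>. exp (- ?W \<omega>)) / exp (- a)"
    using integral_Markov_inequality_measure[OF iW, of "{}" "exp (- a)"] by simp
  also have "\<dots> \<le> exp (- card J / 2) / exp (- a)"
    unfolding EW using pw by (intro divide_right_mono) auto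
  also have "\<dots> = exp (a - card J / 2)" by (simp flip: exp_diff)
  finally show ?thesis .
qed

end

end

lemma (in prob_space) std_normal_tail:
  assumes [measurable]: "X \<in> borel_measurable M"
    and "distr M borel X = std_normal_distribution" and "0 < K"
  shows "prob {\<omega>\<in>space M. K \<le> \<bar>X \<omega>\<bar>} \<le> 1 / K\<^sup>2"
proof -
  have "integrable M (\<lambda>\<omega>. (X \<omega>)\<^sup>2)"
    using integrable_std_normal_distribution_moment[of 2]
    unfolding assms(2)[symmetric] by (simp add: integrable_distr_eq)
  moreover have "expectation (\<lambda>\<omega>. (X \<omega>)\<^sup>2) = 1"
    using std_normal_moments(1) unfolding assms(2)[symmetric] by (simp add: integral_distr)
  ultimately show ?thesis using second_moment_method[of X K] assms by auto
qed

section \<open>Coordinates of independent Gaussian vectors and their normalized sums\<close>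

lemma (in prob_space) indep_vars_vec_coords:
  fixes X :: "'i \<Rightarrow> 'a \<Rightarrow> 'j \<Rightarrow> real" and N :: "real measure"
  assumes I: "finite I" "I \<noteq> {}" and J: "finite J" "J \<noteq> {}"
    and N: "real_distribution N"
    and ind: "indep_vars (\<lambda>_. \<Pi>\<^sub>M j\<in>J. borel) X I"
    and law: "\<And>i. i \<in> I \<Longrightarrow> distr M (\<Pi>\<^sub>M j\<in>J. borel) (X i) = (\<Pi>\<^sub>M j\<in>J. N)"
  shows "\<And>i j. i \<in> I \<Longrightarrow> j \<in> J \<Longrightarrow> distr M borel (\<lambda>\<omega>. X i \<omega> j) = N"
    and "indep_vars (\<lambda>_. borel) (\<lambda>(i, j) \<omega>. X i \<omega> j) (I \<times> J)"
proof -
  interpret N: real_distribution N by (rule N)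
  interpret P: finite_product_prob_space "\<lambda>_. N" J by standard (rule J)
  have rvX: "X i \<in> M \<rightarrow>\<^sub>M (\<Pi>\<^sub>M j\<in>J. borel)" if "i \<in> I" for i
    using ind that by (auto simp: indep_vars_def)
  have rv: "(\<lambda>\<omega>. X i \<omega> j) \<in> borel_measurable M" if "i \<in> I" "j \<in> J" for i j
    using measurable_compose[OF rvX[OF that(1)] measurable_component_singleton[OF that(2)]] .
  show law1: "distr M borel (\<lambda>\<omega>. X i \<omega> j) = N" if "i \<in> I" "j \<in> J" for i j
  proof -
    have "distr M borel (\<lambda>\<omega>. X i \<omega> j) = distr (distr M (\<Pi>\<^sub>M j\<in>J. borel) (X i)) borel (\<lambda>x. x j)"
      using rvX that by (subst distr_distr) (auto simp: comp_def)
    also have "\<dots> = distr (\<Pi>\<^sub>M j\<in>J. N) N (\<lambda>x. x j)"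
      unfolding law[OF that(1)] by (intro distr_cong) auto
    also have "\<dots> = N" by (rule P.PiM_component) (rule that)
    finally show ?thesis .
  qed
  have prob1: "prob ((\<lambda>\<omega>. X i \<omega> j) -` A \<inter> space M) = measure N A"
    if "i \<in> I" "j \<in> J" "A \<in> sets borel" for i j A
    unfolding law1[OF that(1,2), symmetric] using rv that by (subst measure_distr) auto
  have probX: "prob (X i -` (\<Pi>\<^sub>E j\<in>J. A j) \<inter> space M) = (\<Prod>j\<in>J. measure N (A j))"
    if "i \<in> I" "\<And>j. j \<in> J \<Longrightarrow> A j \<in> sets borel" for i A
  proof -
    have "prob (X i -` (\<Pi>\<^sub>E j\<in>J. A j) \<inter> space M) = measure (\<Pi>\<^sub>M j\<in>J. N) (\<Pi>\<^sub>E j\<in>J. A j)"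
      unfolding law[OF that(1), symmetric]
      using rvX that J by (subst measure_distr) (auto intro!: sets_PiM_I_finite)
    also have "\<dots> = (\<Prod>j\<in>J. measure N (A j))" using that by (intro P.prob_times) auto
    finally show ?thesis .
  qed
  show "indep_vars (\<lambda>_. borel) (\<lambda>(i, j) \<omega>. X i \<omega> j) (I \<times> J)"
  \<comment> \<open>The Borel sets form an intersection-stable generator, so it suffices that
    probabilities of boxes factor: over \<open>i\<close> by independence of the vectors, and over
    \<open>j\<close> by the product form of each law.\<close>
  proof (subst indep_vars_finite[where E = "\<lambda>_. sets borel"])
    show "\<forall>A\<in>I \<times> J \<rightarrow> sets borel.
        prob (\<Inter>k\<in>I \<times> J. (case k of (i, j) \<Rightarrow> \<lambda>\<omega>. X i \<omega> j) -` A k \<inter> space M) =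
        (\<Prod>k\<in>I \<times> J. prob ((case k of (i, j) \<Rightarrow> \<lambda>\<omega>. X i \<omega> j) -` A k \<inter> space M))"
    proof
      fix A assume A: "A \<in> I \<times> J \<rightarrow> sets (borel :: real measure)"
      have inter: "(\<Inter>k\<in>I \<times> J. (case k of (i, j) \<Rightarrow> \<lambda>\<omega>. X i \<omega> j) -` A k \<inter> space M)
          = (\<Inter>i\<in>I. X i -` (\<Pi>\<^sub>E j\<in>J. A (i, j)) \<inter> space M)"
        using I J measurable_space[OF rvX] by (auto simp: PiE_iff space_PiM)
      have "prob (\<Inter>k\<in>I \<times> J. (case k of (i, j) \<Rightarrow> \<lambda>\<omega>. X i \<omega> j) -` A k \<inter> space M)
          = (\<Prod>i\<in>I. prob (X i -` (\<Pi>\<^sub>E j\<in>J. A (i, j)) \<inter> space M))"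
        unfolding inter
        by (intro indep_varsD_finite[OF ind I(2,1)] sets_PiM_I_finite) (use A J in auto)
      also have "\<dots> = (\<Prod>i\<in>I. \<Prod>j\<in>J. measure N (A (i, j)))"
        using A by (intro prod.cong probX) auto
      also have "\<dots> = (\<Prod>(i, j)\<in>I \<times> J. measure N (A (i, j)))" by (rule prod.cartesian_product)
      also have "\<dots> = (\<Prod>k\<in>I \<times> J. prob ((case k of (i, j) \<Rightarrow> \<lambda>\<omega>. X i \<omega> j) -` A k \<inter> space M))"
        using A by (intro prod.cong) (auto intro!: prob1[symmetric])
      finally show "prob (\<Inter>k\<in>I \<times> J. (case k of (i, j) \<Rightarrow> \<lambda>\<omega>. X i \<omega> j) -` A k \<inter> space M)
          = (\<Prod>k\<in>I \<times> J. prob ((case k of (i, j) \<Rightarrow> \<lambda>\<omega>. X i \<omega> j) -` A k \<inter> space M))" .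
    qed
  qed (use I J rv in \<open>auto simp: Int_stable_def sets.sigma_sets_eq[of borel, simplified]\<close>)
qed

text \<open>The columns \<open>I \<times> {j}\<close> are disjoint blocks of an independent family,
  so functions of different columns are independent. Within a column, \<open>card I\<close>
  independent standard normals add up to variance \<open>card I\<close>.\<close>

lemma (in prob_space) indep_normalized_column_sums:
  fixes X :: "'i \<Rightarrow> 'a \<Rightarrow> 'j \<Rightarrow> real"
  assumes I: "finite I" "I \<noteq> {}" and J: "finite J" "J \<noteq> {}"
    and ind: "indep_vars (\<lambda>_. \<Pi>\<^sub>M j\<in>J. borel) X I"
    and law: "\<And>i. i \<in> I \<Longrightarrow>
      distr M (\<Pi>\<^sub>M j\<in>J. borel) (X i) = (\<Pi>\<^sub>M j\<in>J. std_normal_distribution)"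
  defines "G \<equiv> \<lambda>j \<omega>. (\<Sum>i\<in>I. X i \<omega> j) / sqrt (card I)"
  shows "indep_vars (\<lambda>_. borel) G J"
    and "\<And>j. j \<in> J \<Longrightarrow> distr M borel (G j) = std_normal_distribution"
proof -
  note coords = indep_vars_vec_coords[OF I J real_dist_normal_dist ind law]
  let ?X = "\<lambda>(i, j) \<omega>. X i \<omega> j"
  have sum: "(\<Sum>k\<in>I \<times> {j}. h k) = (\<Sum>i\<in>I. h (i, j))" for h :: "'i \<times> 'j \<Rightarrow> real" and j
    using sum.cartesian_product[of "\<lambda>i j. h (i, j)" "{j}" I] by simp
  have "indep_vars (\<lambda>j. \<Pi>\<^sub>M k\<in>I \<times> {j}. borel) (\<lambda>j \<omega>. restrict (\<lambda>k. ?X k \<omega>) (I \<times> {j})) J"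
    by (rule indep_vars_restrict[OF coords(2)]) (auto simp: disjoint_family_on_def)
  then have "indep_vars (\<lambda>_. borel)
      (\<lambda>j \<omega>. (\<Sum>k\<in>I \<times> {j}. restrict (\<lambda>k. ?X k \<omega>) (I \<times> {j}) k) / sqrt (card I)) J"
    by (rule indep_vars_compose2) measurable
  then show "indep_vars (\<lambda>_. borel) G J" by (simp add: G_def sum)
  fix j assume j: "j \<in> J"
  have c: "0 < sqrt (card I)" using I by (simp add: card_gt_0_iff)
  have "distributed M lborel (?X k) (normal_density 0 1)" if "k \<in> I \<times> {j}" for k
  proof -
    obtain i where k: "k = (i, j)" "i \<in> I" using \<open>k \<in> I \<times> {j}\<close> by auto
    have "?X k \<in> borel_measurable M"
      using coords(2) k j by (auto simp: indep_vars_def)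
    moreover have "distr M lborel (?X k) = std_normal_distribution"
      using coords(1)[OF _ k(2) j] by (simp add: k(1) cong: distr_cong)
    ultimately show ?thesis by (simp add: distributed_def)
  qed
  then have "distributed M lborel (\<lambda>\<omega>. \<Sum>k\<in>I \<times> {j}. ?X k \<omega>)
      (normal_density (\<Sum>k\<in>I \<times> {j}. 0) (sqrt (\<Sum>k\<in>I \<times> {j}. 1\<^sup>2)))"
    using I j by (intro sum_indep_normal indep_vars_subset[OF coords(2)]) auto
  then have "distributed M lborel (\<lambda>\<omega>. \<Sum>i\<in>I. X i \<omega> j) (normal_density 0 (sqrt (card I)))"
    by (simp add: sum card_cartesian_product)
  from normal_density_affine[OF this c, of "1 / sqrt (card I)" 0]
  have "distributed M lborel (G j) std_normal_density" using c by (simp add: G_def)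
  then have "distr M lborel (G j) = std_normal_distribution" by (rule distributed_distr_eq_density)
  then show "distr M borel (G j) = std_normal_distribution" by (simp cong: distr_cong)
qed

section \<open>Means and continuity of the limit laws\<close>

lemma std_normal_shift_mean: "(\<integral>x. x - \<kappa> \<partial>std_normal_distribution) = - \<kappa>"
  and std_normal_shift_sq_mean: "(\<integral>x. (x - \<kappa>)\<^sup>2 \<partial>std_normal_distribution) = 1 + \<kappa>\<^sup>2"
proof -
  interpret N: prob_space std_normal_distribution by (rule prob_space_normal_density) simp
  note int = integrable_std_normal_distribution_moment[of 1] integrable_std_normal_distribution_moment[of 2]
  have m1: "(\<integral>x. x \<partial>std_normal_distribution) = 0"
    using integral_std_normal_distribution_moment_odd[of 1] by simp
  show "(\<integral>x. x - \<kappa> \<partial>std_normal_distribution) = - \<kappa>"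
    using int m1 N.prob_space by simp
  have "(x - \<kappa>)\<^sup>2 = x\<^sup>2 - 2 * \<kappa> * x + \<kappa>\<^sup>2" for x by (simp add: power2_diff)
  then show "(\<integral>x. (x - \<kappa>)\<^sup>2 \<partial>std_normal_distribution) = 1 + \<kappa>\<^sup>2"
    using int m1 std_normal_moments(1) N.prob_space by simp
qed

lemma real_distribution_std_normal_image:
  "f \<in> borel_measurable borel \<Longrightarrow> real_distribution (distr std_normal_distribution borel f)"
  by (intro prob_space.real_distribution_distr prob_space_normal_density) auto

text \<open>The preimage of a point under squaring has at most two elements, hence measure zero.
  Weak convergence to this law therefore gives convergence of the distribution functions at every
  point.\<close>

lemma chi_square_1_continuous: "isCont (cdf chi_square_1) x"
proof -
  interpret C: real_distribution chi_square_1
    unfolding chi_square_1_def by (intro real_distribution_std_normal_image) auto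
  have fin: "finite ((\<lambda>y::real. y\<^sup>2) -` {x})"
  proof (rule finite_subset)
    show "(\<lambda>y::real. y\<^sup>2) -` {x} \<subseteq> {sqrt x, - sqrt x}"
      by (auto simp: real_sqrt_abs) 
  qed simp
  have "emeasure chi_square_1 {x} = emeasure std_normal_distribution ((\<lambda>y::real. y\<^sup>2) -` {x})"
    unfolding chi_square_1_def by (subst emeasure_distr) auto
  also have "\<dots> = 0"
    using finite_imp_null_set_lborel[OF fin] null_setsD2[OF finite_imp_null_set_lborel[OF fin]]
    by (subst emeasure_density) (auto intro: nn_integral_null_set)
  finally show ?thesis by (simp add: C.isCont_cdf C.emeasure_eq_measure)
qed

section \<open>Subsequences and a summable comparison sequence\<close>

lemma not_Bseq_nonneg_frequently_ge:
  fixes x :: "nat \<Rightarrow> real"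
  assumes "\<not> Bseq x" "\<And>n. 0 \<le> x n"
  shows "\<exists>n\<ge>N. L \<le> x n"
proof (rule ccontr)
  assume "\<not> (\<exists>n\<ge>N. L \<le> x n)"
  then have "x (n + N) < L" for n by (force simp: not_le)
  then have "norm (x (n + N)) \<le> L" for n using assms(2)[of "n + N"] less_imp_le by fastforce
  then have "Bseq (\<lambda>n. x (n + N))" by (rule BseqI')
  then show False using assms(1) Bseq_offset by blast
qed

text \<open>Bolzano-Weierstrass is applied along the infinitely many indices with
  \<open>e \<le> \<bar>x n\<bar>\<close>, so the limit also stays away from 0. The shift by
  \<open>Suc\<close> keeps the indices at least 1.\<close>

lemma Bseq_not_null_subseq_limit:
  fixes x :: "nat \<Rightarrow> real"
  assumes "Bseq x" "\<not> x \<longlonglongrightarrow> 0"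
  obtains r \<kappa> where "strict_mono (r :: nat \<Rightarrow> nat)" "\<And>k. 1 \<le> r k" "\<kappa> \<noteq> 0" "(\<lambda>k. x (r k)) \<longlonglongrightarrow> \<kappa>"
proof -
  obtain e where e: "0 < e" "\<And>N. \<exists>n\<ge>N. e \<le> \<bar>x n\<bar>"
    using assms(2) by (force simp: LIMSEQ_iff not_less)
  have "infinite {n. e \<le> \<bar>x n\<bar>}"
    unfolding infinite_nat_iff_unbounded_le using e(2) by auto
  from infinite_enumerate[OF this] obtain s
    where s: "strict_mono (s :: nat \<Rightarrow> nat)" "\<And>k. s k \<in> {n. e \<le> \<bar>x n\<bar>}" by blast
  have "bounded (range x)" using assms(1) by (simp add: Bseq_eq_bounded)
  then have "bounded (range (x \<circ> s))" by (rule bounded_subset) auto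
  then obtain \<kappa> t where t: "strict_mono t" "(x \<circ> s \<circ> t) \<longlonglongrightarrow> \<kappa>"
    using bounded_imp_convergent_subsequence by blast
  let ?r = "\<lambda>k. s (t (Suc k))"
  have "strict_mono ?r" using s(1) t(1) by (simp add: strict_mono_def)
  moreover have "1 \<le> ?r k" for k
    using seq_suble[OF strict_mono_o[OF s(1) t(1)], of "Suc k"] by (simp add: comp_def)
  moreover have lim: "(\<lambda>k. x (?r k)) \<longlonglongrightarrow> \<kappa>"
    using LIMSEQ_Suc[OF t(2)] by (simp add: comp_def)
  moreover have "e \<le> \<bar>\<kappa>\<bar>"
    by (rule LIMSEQ_le_const[OF tendsto_rabs[OF lim]]) (use s(2) in auto)
  ultimately show ?thesis using that[of ?r \<kappa>] e(1) by auto
qed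

lemma summable_exp_neg_sqrt: "summable (\<lambda>n. exp (- sqrt (real n)))"
proof (rule summable_comparison_test_ev)
  have "\<forall>\<^sub>F n in sequentially. exp (- sqrt (real n)) \<le> 1 / real n ^ 2"
    by real_asymp
  then show "\<forall>\<^sub>F n in sequentially. norm (exp (- sqrt (real n))) \<le> 1 / real n ^ 2"
    by simp
  show "summable (\<lambda>n. 1 / real n ^ 2)" by (rule inverse_power_summable[of 2, simplified inverse_eq_divide]) simp
qed

section \<open>The model with growing dimension\<close>

text \<open>The noise is a triangular array: nothing relates the rows of different \<open>n\<close>,
  so the almost sure claim rests on summable tail bounds.\<close>

locale quadratic_model = prob_space M for M :: "'a measure" +
  fixes p :: "nat \<Rightarrow> nat" and \<epsilon> :: "nat \<Rightarrow> nat \<Rightarrow> 'a \<Rightarrow> nat \<Rightarrow> real"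
  assumes p_pos: "1 \<le> p n"
    and indep_noise: "indep_vars (\<lambda>_. borel_vec (p n)) (\<epsilon> n) {1..n}"
    and noise_law: "i \<in> {1..n} \<Longrightarrow> distr M (borel_vec (p n)) (\<epsilon> n i) = std_gaussian_vec (p n)"
begin

text \<open>Coordinates from \<open>p n\<close> on are set to \<open>0\<close> because nothing is known about their
  measurability.  For \<open>n = 0\<close> all coordinates are \<open>0\<close>, as \<open>x / 0 = 0\<close>.\<close>
definition noise_mean :: "nat \<Rightarrow> 'a \<Rightarrow> nat \<Rightarrow> real" where
  "noise_mean n \<omega> j = (if j < p n then sample_mean n (\<lambda>i. \<epsilon> n i \<omega>) j else 0)"

definition score :: "nat \<Rightarrow> 'a \<Rightarrow> real" where
  "score n \<omega> = sqrt n * noise_mean n \<omega> 0"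

text \<open>The quantity \<open>V\<close> of the overview; the error of the Fisher expansion is
  \<open>- bias\<close>.\<close>

definition bias :: "nat \<Rightarrow> 'a \<Rightarrow> real" where
  "bias n \<omega> = sqrt n * (L2_set (noise_mean n \<omega>) {1..<p n})\<^sup>2"

definition wilks :: "nat \<Rightarrow> 'a \<Rightarrow> real" where
  "wilks n \<omega> = n * min_misfit (p n) (noise_mean n \<omega>) 0"

definition dim_ratio :: "nat \<Rightarrow> real" where
  "dim_ratio n = real (p n) / sqrt (real n)"

lemma noise_mean_measurable [measurable]: "(\<lambda>\<omega>. noise_mean n \<omega> j) \<in> borel_measurable M"
proof (cases "j < p n")
  case True
  have "(\<lambda>\<omega>. \<epsilon> n i \<omega> j) \<in> borel_measurable M" if "i \<in> {1..n}" for i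
  proof -
    have "\<epsilon> n i \<in> M \<rightarrow>\<^sub>M borel_vec (p n)" using indep_noise[of n] that by (auto simp: indep_vars_def)
    from measurable_compose[OF this measurable_component_singleton[of j]] show ?thesis
      using True by simp
  qed
  then show ?thesis using True by (simp add: noise_mean_def sample_mean_def)
qed (simp add: noise_mean_def)

lemma score_measurable [measurable]: "score n \<in> borel_measurable M"
  unfolding score_def[abs_def] by measurable

lemma bias_measurable [measurable]: "bias n \<in> borel_measurable M"
  unfolding bias_def[abs_def] L2_set_def by measurable

lemma wilks_measurable [measurable]: "wilks n \<in> borel_measurable M"
  unfolding wilks_def[abs_def] by (intro borel_measurable_times borel_measurable_min_misfit) auto

lemma bias_nonneg: "0 \<le> bias n \<omega>"
  by (simp add: bias_def)

lemma dim_ratio_nonneg: "0 \<le> dim_ratio n"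
  by (simp add: dim_ratio_def)

lemma normalized_noise_mean:
  assumes "1 \<le> n"
  defines "G \<equiv> \<lambda>j \<omega>. sqrt n * noise_mean n \<omega> j"
  shows "indep_vars (\<lambda>_. borel) G {..<p n}"
    and "\<And>j. j < p n \<Longrightarrow> distr M borel (G j) = std_normal_distribution"
proof -
  have I: "finite {1..n}" "{1..n} \<noteq> {}" and J: "finite {..<p n}" "{..<p n} \<noteq> {}"
    using assms p_pos[of n] by (auto simp: lessThan_empty_iff)
  have law: "distr M (\<Pi>\<^sub>M j\<in>{..<p n}. borel) (\<epsilon> n i) = (\<Pi>\<^sub>M j\<in>{..<p n}. std_normal_distribution)"
    if "i \<in> {1..n}" for i
    using noise_law[OF that] by (simp add: std_gaussian_vec_def)
  have G: "G j = (\<lambda>\<omega>. (\<Sum>i\<in>{1..n}. \<epsilon> n i \<omega> j) / sqrt (card {1..n}))" if "j < p n" for j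
  proof
    fix \<omega> show "G j \<omega> = (\<Sum>i\<in>{1..n}. \<epsilon> n i \<omega> j) / sqrt (card {1..n})"
      using that assms by (simp add: G_def noise_mean_def sample_mean_def real_div_sqrt field_simps)
  qed
  note * = indep_normalized_column_sums[OF I J indep_noise law]
  show "indep_vars (\<lambda>_. borel) G {..<p n}"
    using *(1) by (rule indep_vars_cong[THEN iffD1, rotated -1]) (auto simp: G)
  show "distr M borel (G j) = std_normal_distribution" if "j < p n" for j
    using *(2)[of j] that by (simp add: G)
qed

lemma score_law: "1 \<le> n \<Longrightarrow> distr M borel (score n) = std_normal_distribution"
  using normalized_noise_mean(2)[of n 0] p_pos[of n] by (simp add: score_def[abs_def])

text \<open>Exhibits \<open>sqrt n * bias\<close> as a sum of squares over the
  \<open>p n - 1\<close> nuisance coordinates, which for \<open>n \<ge> 1\<close> are independent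
  standard normals, so that the chi-square bounds apply.\<close>

lemma sqrt_mult_bias:
  "sqrt n * bias n \<omega> = (\<Sum>j\<in>{1..<p n}. (sqrt n * noise_mean n \<omega> j)\<^sup>2)"
  by (simp add: bias_def L2_set_def sum_nonneg power_mult_distrib flip: sum_distrib_left mult.assoc)

section \<open>Deviation bounds for the bias and the score\<close>

lemma nuisance_indep:
  assumes "1 \<le> n"
  shows "indep_vars (\<lambda>_. borel) (\<lambda>j \<omega>. sqrt n * noise_mean n \<omega> j) {1..<p n}"
    and "\<And>j. j \<in> {1..<p n} \<Longrightarrow> distr M borel (\<lambda>\<omega>. sqrt n * noise_mean n \<omega> j) = std_normal_distribution"
  using normalized_noise_mean[OF assms] by (auto intro: indep_vars_subset)

lemma bias_Chebyshev:
  assumes "1 \<le> n" "0 < a"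
  shows "prob {\<omega>\<in>space M. a \<le> \<bar>bias n \<omega> - real (p n - 1) / sqrt n\<bar>} \<le> 2 * real (p n - 1) / (n * a\<^sup>2)"
proof -
  have n: "0 < sqrt n" using assms by simp
  have "a \<le> \<bar>b - m / sqrt n\<bar> \<longleftrightarrow> sqrt n * a \<le> \<bar>sqrt n * b - m\<bar>" for b m
  proof -
    have "sqrt n * b - m = sqrt n * (b - m / sqrt n)" using n by (simp add: field_simps)
    then show ?thesis using n by (simp add: abs_mult)
  qed
  then show ?thesis
    using chi_square_Chebyshev[OF _ nuisance_indep[OF assms(1)], of "sqrt n * a"] n assms
    by (simp add: sqrt_mult_bias power_mult_distrib)
qed

lemma bias_lower_tail:
  assumes "1 \<le> n" "(2 * B + 2 * c + 1) * sqrt n \<le> p n"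
  shows "prob {\<omega>\<in>space M. bias n \<omega> \<le> B} \<le> exp (- c * sqrt n)"
proof -
  have n: "1 \<le> sqrt n" using assms by simp
  have "bias n \<omega> \<le> B \<longleftrightarrow> sqrt n * bias n \<omega> \<le> sqrt n * B" for \<omega> using n by simp
  then have "prob {\<omega>\<in>space M. bias n \<omega> \<le> B} \<le> exp (sqrt n * B - real (p n - 1) / 2)"
    using chi_square_lower_tail[OF _ nuisance_indep[OF assms(1)], of "sqrt n * B"]
    by (simp add: sqrt_mult_bias)
  \<comment> \<open>The extra 1 in the assumed factor pays for passing from \<open>p n\<close> to
    \<open>p n - 1\<close>, since \<open>sqrt n \<ge> 1\<close>.\<close>
  also have "sqrt n * B - real (p n - 1) / 2 \<le> - c * sqrt n"
  proof -
    have "2 * (sqrt n * B) + 2 * (c * sqrt n) + sqrt n \<le> p n"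
      using assms(2) by (simp add: algebra_simps)
    moreover have "real (p n - 1) = p n - 1" using p_pos[of n] by (simp add: of_nat_diff)
    ultimately show ?thesis using n by linarith
  qed
  finally show ?thesis by simp
qed

lemma bias_lower_tail_const:
  assumes "(2 * B + 2 * c + 1) \<le> dim_ratio n" "1 \<le> n" "0 \<le> c"
  shows "prob {\<omega>\<in>space M. bias n \<omega> \<le> B} \<le> exp (- c)"
proof -
  have n: "1 \<le> sqrt n" using assms by simp
  then have "prob {\<omega>\<in>space M. bias n \<omega> \<le> B} \<le> exp (- c * sqrt n)"
    using assms by (intro bias_lower_tail) (simp_all add: dim_ratio_def pos_le_divide_eq)
  also have "\<dots> \<le> exp (- c)" using n assms mult_left_mono[OF n, of c] by simp
  finally show ?thesis .
qed

lemma score_tail: "1 \<le> n \<Longrightarrow> 0 < K \<Longrightarrow> prob {\<omega>\<in>space M. K \<le> \<bar>score n \<omega>\<bar>} \<le> 1 / K\<^sup>2"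
  by (rule std_normal_tail[OF score_measurable score_law])

section \<open>Pointwise bounds for the Wilks statistic\<close>

lemma wilks_approx:
  assumes "1 \<le> n"
  defines "q \<equiv> \<lambda>\<omega>. \<bar>score n \<omega> - bias n \<omega>\<bar>"
  shows "wilks n \<omega> \<le> (q \<omega>)\<^sup>2"
    and "(q \<omega>)\<^sup>2 * (1 - 2 * (2 * sqrt (bias n \<omega> / sqrt n) + q \<omega> / sqrt n)) \<le> wilks n \<omega>"
proof -
  let ?z = "noise_mean n \<omega>" and ?s = "L2_set (noise_mean n \<omega>) {1..<p n}"
  have n: "0 < sqrt n" using assms by simp
  have nn: "real n = (sqrt n)\<^sup>2" by simp
  \<comment> \<open>In terms of \<open>score\<close> and \<open>bias\<close> the first residual is
    \<open>q / sqrt n\<close> and the norm of the nuisance part is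
    \<open>sqrt (bias / sqrt n)\<close>; multiplying the two bounds on \<open>min_misfit\<close> by
    \<open>n\<close> gives both claims.\<close>
  have q: "\<bar>?z 0 - ?s\<^sup>2\<bar> = q \<omega> / sqrt n"
    using n by (simp add: q_def score_def bias_def abs_mult flip: right_diff_distrib)
  have s: "?s = sqrt (bias n \<omega> / sqrt n)"
    using n by (simp add: bias_def L2_set_nonneg)
  show "wilks n \<omega> \<le> (q \<omega>)\<^sup>2"
  proof -
    have "wilks n \<omega> \<le> n * (\<bar>?z 0 - ?s\<^sup>2\<bar>)\<^sup>2"
      unfolding wilks_def using min_misfit_le_sq[of "p n" ?z 0] by (intro mult_left_mono) auto
    also have "\<dots> = (q \<omega>)\<^sup>2" unfolding q using n by (simp add: power_divide)
    finally show ?thesis .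
  qed
  show "(q \<omega>)\<^sup>2 * (1 - 2 * (2 * sqrt (bias n \<omega> / sqrt n) + q \<omega> / sqrt n)) \<le> wilks n \<omega>"
  proof -
    have "(q \<omega>)\<^sup>2 * (1 - 2 * (2 * ?s + q \<omega> / sqrt n)) = n * ((q \<omega> / sqrt n)\<^sup>2 * (1 - 2 * (2 * ?s + q \<omega> / sqrt n)))"
      using n by (simp add: power_divide)
    also have "\<dots> \<le> wilks n \<omega>"
    proof -
      have "\<bar>?z 0 - ?s\<^sup>2\<bar>\<^sup>2 * (1 - 2 * (2 * ?s + \<bar>?z 0 - ?s\<^sup>2\<bar>)) \<le> min_misfit (p n) ?z 0"
        using min_misfit_ge_sq[where p = "p n" and z = ?z and \<theta> = 0] by simp
      then show ?thesis unfolding wilks_def q by (intro mult_left_mono) auto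
    qed
    finally show ?thesis unfolding s .
  qed
qed

text \<open>Multiplied by \<open>n\<close>, the two terms of \<open>min_misfit_ge_min\<close> become
  \<open>sqrt n * bias / 4\<close> and \<open>(bias / 4 - score)^2\<close>. The threshold is chosen
  so that \<open>bias / 4 - score\<close> exceeds \<open>c + 1\<close>.\<close>

lemma wilks_large:
  fixes c K :: real
  assumes "1 \<le> n" "0 \<le> c" "\<bar>score n \<omega>\<bar> < K" "4 * (K + c + 1) < bias n \<omega>"
  shows "c < wilks n \<omega>"
proof -
  let ?z = "noise_mean n \<omega>" and ?s = "L2_set (noise_mean n \<omega>) {1..<p n}"
  let ?b = "bias n \<omega>" and ?x = "score n \<omega>"
  have n: "1 \<le> sqrt n" using assms by simp
  have "?z 0 \<le> ?s\<^sup>2 / 4"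
  proof -
    have "?x < K" using assms(3) by simp
    then have "?x \<le> ?b / 4" using assms(2,4) by (simp add: field_simps)
    then have "sqrt n * ?z 0 \<le> sqrt n * (?s\<^sup>2 / 4)"
      by (simp only: score_def bias_def times_divide_eq_right)
    then show ?thesis using n by simp
  qed
  then have "min (?s\<^sup>2 / 4) ((?s\<^sup>2 / 4 - ?z 0)\<^sup>2) \<le> min_misfit (p n) ?z 0"
    using min_misfit_ge_min[of ?z 0 "p n"] by simp
  then have "n * min (?s\<^sup>2 / 4) ((?s\<^sup>2 / 4 - ?z 0)\<^sup>2) \<le> wilks n \<omega>"
    unfolding wilks_def by (intro mult_left_mono) auto
  moreover have "c < n * (?s\<^sup>2 / 4)"
  proof -
    have "c < 1 * (?b / 4)" using assms by simp
    also have "\<dots> \<le> sqrt n * (?b / 4)" using n bias_nonneg[of n \<omega>] by (intro mult_right_mono) auto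
    also have "\<dots> = n * (?s\<^sup>2 / 4)" using n by (simp add: bias_def flip: mult.assoc)
    finally show ?thesis .
  qed
  moreover have "c < n * ((?s\<^sup>2 / 4 - ?z 0)\<^sup>2)"
  proof -
    have "c < (c + 1)\<^sup>2" using assms(2) by (simp add: power2_eq_square algebra_simps add_pos_nonneg)
    also have "\<dots> \<le> (?b / 4 - ?x)\<^sup>2" using assms by (intro power_mono) auto
    also have "?b / 4 - ?x = sqrt n * (?s\<^sup>2 / 4 - ?z 0)" by (simp add: bias_def score_def algebra_simps)
    also have "(\<dots>)\<^sup>2 = n * ((?s\<^sup>2 / 4 - ?z 0)\<^sup>2)" by (simp add: power_mult_distrib)
    finally show ?thesis .
  qed
  ultimately show ?thesis by (auto simp: min_def split: if_splits)
qed

lemma score_bias_tail: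
  assumes "1 \<le> n" "2 * B + 7 \<le> dim_ratio n"
  shows "prob {\<omega>\<in>space M. 2 \<le> \<bar>score n \<omega>\<bar> \<or> bias n \<omega> \<le> B} \<le> 1 / 2"
proof -
  have "prob {\<omega>\<in>space M. 2 \<le> \<bar>score n \<omega>\<bar> \<or> bias n \<omega> \<le> B}
      = prob ({\<omega>\<in>space M. 2 \<le> \<bar>score n \<omega>\<bar>} \<union> {\<omega>\<in>space M. bias n \<omega> \<le> B})"
    by (intro arg_cong[where f = prob]) auto
  also have "\<dots> \<le> prob {\<omega>\<in>space M. 2 \<le> \<bar>score n \<omega>\<bar>} + prob {\<omega>\<in>space M. bias n \<omega> \<le> B}"
    by (rule measure_Un_le) measurable
  \<comment> \<open>The score has tail at most \<open>1 / 2^2\<close>. The 7 in the assumption is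
    \<open>2 * 3 + 1\<close>, which yields \<open>exp (- 3)\<close> for the bias.\<close>
  also have "\<dots> \<le> 1 / 4 + exp (- 3)"
    using score_tail[of n 2] bias_lower_tail_const[of B 3 n] assms by (intro add_mono) auto
  also have "exp (- 3) \<le> (1/4 :: real)"
    using exp_ge_add_one_self[of "3::real"] by (simp add: exp_minus field_simps)
  finally show ?thesis by simp
qed

section \<open>Limits along subsequences on which the dimension ratio converges\<close>

lemma bias_tendsto_in_prob:
  assumes r: "strict_mono r" "\<And>k. 1 \<le> r k" and lim: "(\<lambda>k. dim_ratio (r k)) \<longlonglongrightarrow> \<kappa>"
  shows "tendsto_zero_in_prob M (\<lambda>k \<omega>. bias (r k) \<omega> - \<kappa>)"
  unfolding tendsto_zero_in_prob_def
proof safe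
  fix e :: real assume e: "0 < e"
  \<comment> \<open>The mean of the bias; it differs from \<open>dim_ratio\<close> by
    \<open>1 / sqrt (r k)\<close>, as only \<open>p - 1\<close> coordinates contribute, and so has
    the same limit.\<close>
  let ?m = "\<lambda>k. real (p (r k) - 1) / sqrt (r k)"
  have "filterlim (\<lambda>k. sqrt (real (r k))) at_top sequentially"
    by (intro filterlim_compose[OF sqrt_at_top] filterlim_compose[OF filterlim_real_sequentially]
        filterlim_subseq r)
  then have inv: "(\<lambda>k. 1 / sqrt (r k)) \<longlonglongrightarrow> 0"
    by (intro tendsto_divide_0[OF tendsto_const] filterlim_at_top_imp_at_infinity)
  have "?m k = dim_ratio (r k) - 1 / sqrt (r k)" for k
    using p_pos[of "r k"] by (simp add: dim_ratio_def of_nat_diff diff_divide_distrib)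
  then have m: "?m \<longlonglongrightarrow> \<kappa>" using tendsto_diff[OF lim inv] by simp
  have "\<forall>\<^sub>F k in sequentially. dist (?m k) \<kappa> < e / 2" using m e by (intro tendstoD) auto
  then have "\<forall>\<^sub>F k in sequentially. prob {\<omega>\<in>space M. \<bar>bias (r k) \<omega> - \<kappa>\<bar> > e} \<le> ?m k * (8 / e\<^sup>2 * (1 / sqrt (r k)))"
  proof eventually_elim
    case (elim k)
    have "prob {\<omega>\<in>space M. \<bar>bias (r k) \<omega> - \<kappa>\<bar> > e} \<le> prob {\<omega>\<in>space M. e / 2 \<le> \<bar>bias (r k) \<omega> - ?m k\<bar>}"
    proof (intro finite_measure_mono subsetI)
      fix \<omega> assume "\<omega> \<in> {\<omega>\<in>space M. \<bar>bias (r k) \<omega> - \<kappa>\<bar> > e}"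
      then have "\<omega> \<in> space M" "e < \<bar>bias (r k) \<omega> - \<kappa>\<bar>" by auto
      moreover have "\<bar>bias (r k) \<omega> - \<kappa>\<bar> \<le> \<bar>bias (r k) \<omega> - ?m k\<bar> + \<bar>?m k - \<kappa>\<bar>" by linarith
      moreover have "\<bar>?m k - \<kappa>\<bar> < e / 2" using elim by (simp only: dist_real_def)
      ultimately show "\<omega> \<in> {\<omega>\<in>space M. e / 2 \<le> \<bar>bias (r k) \<omega> - ?m k\<bar>}" by auto
    qed measurable
    also have "\<dots> \<le> 2 * real (p (r k) - 1) / (r k * (e / 2)\<^sup>2)"
      using e r by (intro bias_Chebyshev) auto
    \<comment> \<open>In this form the bound is a convergent sequence times a null sequence.\<close>
    also have "\<dots> = ?m k * (8 / e\<^sup>2 * (1 / sqrt (r k)))"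
    proof -
      have "2 * m / (S * S * (e / 2)\<^sup>2) = m / S * (8 / e\<^sup>2 * (1 / S))" for m S
        by (simp add: power_divide ac_simps)
      from this[of "real (p (r k) - 1)" "sqrt (r k)"] show ?thesis
        by (simp only: real_sqrt_mult_self abs_of_nat)
    qed
    finally show ?case .
  qed
  note upper = this
  have "(\<lambda>k. ?m k * (8 / e\<^sup>2 * (1 / sqrt (r k)))) \<longlonglongrightarrow> \<kappa> * (8 / e\<^sup>2 * 0)"
    by (intro tendsto_mult m inv tendsto_const)
  then have upper_lim: "(\<lambda>k. ?m k * (8 / e\<^sup>2 * (1 / sqrt (r k)))) \<longlonglongrightarrow> 0" by simp
  show "(\<lambda>k. prob {\<omega>\<in>space M. \<bar>bias (r k) \<omega> - \<kappa>\<bar> > e}) \<longlonglongrightarrow> 0"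
    by (rule tendsto_sandwich[OF _ upper tendsto_const upper_lim]) simp
qed

text \<open>Here \<open>B\<close> bounds both \<open>bias\<close> and
  \<open>\<bar>score - bias\<bar>\<close>. The first term of the bound is the gap in
  \<open>wilks_approx\<close>; the second comes from replacing \<open>bias\<close> by
  \<open>\<kappa>\<close> inside the square, by factoring a difference of squares.\<close>

lemma wilks_dist_le:
  assumes "1 \<le> n" "\<bar>score n \<omega>\<bar> < K" "\<bar>bias n \<omega> - \<kappa>\<bar> \<le> \<tau>" "\<tau> \<le> 1"
  defines "B \<equiv> K + \<bar>\<kappa>\<bar> + 1"
  shows "\<bar>wilks n \<omega> - (score n \<omega> - \<kappa>)\<^sup>2\<bar> \<le> 2 * B\<^sup>2 * (2 * sqrt (B / sqrt n) + B / sqrt n) + 2 * B * \<tau>"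
proof -
  let ?b = "bias n \<omega>" and ?x = "score n \<omega>"
  define q where "q = \<bar>?x - ?b\<bar>"
  define u where "u = 2 * sqrt (?b / sqrt n) + q / sqrt n"
  have n: "0 < sqrt n" using assms by simp
  have K: "0 < K" using assms(2) by linarith
  have q: "0 \<le> q" "q \<le> B" unfolding q_def B_def using assms(2,3,4) by linarith+
  have b: "0 \<le> ?b" "?b \<le> B" using bias_nonneg[of n \<omega>] K assms(3,4) unfolding B_def by linarith+
  have u: "0 \<le> u" "u \<le> 2 * sqrt (B / sqrt n) + B / sqrt n"
    unfolding u_def using q b n by (auto intro!: add_mono divide_right_mono)
  have "q\<^sup>2 * (2 * u) \<le> B\<^sup>2 * (2 * (2 * sqrt (B / sqrt n) + B / sqrt n))"
    using q u by (intro mult_mono power_mono) auto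
  moreover have "wilks n \<omega> \<le> q\<^sup>2" "q\<^sup>2 * (1 - 2 * u) \<le> wilks n \<omega>"
    using wilks_approx[OF assms(1), of \<omega>] by (simp_all add: q_def u_def)
  ultimately have "\<bar>wilks n \<omega> - q\<^sup>2\<bar> \<le> 2 * B\<^sup>2 * (2 * sqrt (B / sqrt n) + B / sqrt n)"
    by (simp add: algebra_simps)
  moreover have "\<bar>q\<^sup>2 - (?x - \<kappa>)\<^sup>2\<bar> \<le> 2 * B * \<tau>"
  proof -
    have "q\<^sup>2 - (?x - \<kappa>)\<^sup>2 = (2 * ?x - ?b - \<kappa>) * (\<kappa> - ?b)"
      by (simp add: q_def power2_eq_square algebra_simps)
    then have "\<bar>q\<^sup>2 - (?x - \<kappa>)\<^sup>2\<bar> = \<bar>2 * ?x - ?b - \<kappa>\<bar> * \<bar>\<kappa> - ?b\<bar>" by (simp add: abs_mult)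
    also have "\<bar>2 * ?x - ?b - \<kappa>\<bar> \<le> 2 * K + 2 * \<bar>\<kappa>\<bar> + 2" using assms(2,3,4) by linarith
    then have "\<bar>2 * ?x - ?b - \<kappa>\<bar> * \<bar>\<kappa> - ?b\<bar> \<le> 2 * B * \<tau>"
      using assms(3) K by (intro mult_mono) (auto simp: B_def)
    finally show ?thesis .
  qed
  ultimately show ?thesis by linarith
qed

lemma wilks_tendsto_in_prob:
  assumes r: "strict_mono r" "\<And>k. 1 \<le> r k" and lim: "(\<lambda>k. dim_ratio (r k)) \<longlonglongrightarrow> \<kappa>"
  shows "tendsto_zero_in_prob M (\<lambda>k \<omega>. wilks (r k) \<omega> - (score (r k) \<omega> - \<kappa>)\<^sup>2)"
  unfolding tendsto_zero_in_prob_def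
proof (intro allI impI)
  fix e :: real assume e: "0 < e"
  let ?P = "\<lambda>k. prob {\<omega>\<in>space M. \<bar>wilks (r k) \<omega> - (score (r k) \<omega> - \<kappa>)\<^sup>2\<bar> > e}"
  show "?P \<longlonglongrightarrow> 0"
  proof (rule LIMSEQ_I)
    fix d :: real assume d: "0 < d"
    \<comment> \<open>\<open>K\<close> makes the score tail at most \<open>d / 2\<close>, the other
      half being left to the bias; \<open>\<tau>\<close> makes the second term of
      \<open>wilks_dist_le\<close> at most \<open>e / 2\<close>, while the first one is eventually
      below \<open>e / 2\<close>.\<close>
    define K where "K = sqrt (2 / d)"
    define B where "B = K + \<bar>\<kappa>\<bar> + 1"
    define \<tau> where "\<tau> = min 1 (e / (4 * B))"
    have K: "0 < K" "1 / K\<^sup>2 = d / 2" using d by (auto simp: K_def)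
    have B: "0 < B" using K by (simp add: B_def)
    have \<tau>: "0 < \<tau>" "\<tau> \<le> 1" using e B by (auto simp: \<tau>_def)
    have "2 * B * \<tau> \<le> 2 * B * (e / (4 * B))" using B by (intro mult_left_mono) (auto simp: \<tau>_def)
    then have \<tau>B: "2 * B * \<tau> \<le> e / 2" using B by simp
    have "filterlim (\<lambda>k. sqrt (real (r k))) at_top sequentially"
      by (intro filterlim_compose[OF sqrt_at_top] filterlim_compose[OF filterlim_real_sequentially]
          filterlim_subseq r)
    then have inv: "(\<lambda>k. B / sqrt (r k)) \<longlonglongrightarrow> 0"
      by (intro tendsto_divide_0[OF tendsto_const] filterlim_at_top_imp_at_infinity)
    have "(\<lambda>k. 2 * B\<^sup>2 * (2 * sqrt (B / sqrt (r k)) + B / sqrt (r k))) \<longlonglongrightarrow> 2 * B\<^sup>2 * (2 * sqrt 0 + 0)"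
      by (intro tendsto_intros inv)
    then have ev1: "\<forall>\<^sub>F k in sequentially. 2 * B\<^sup>2 * (2 * sqrt (B / sqrt (r k)) + B / sqrt (r k)) < e / 2"
      using e by (intro order_tendstoD(2)) auto
    have "(\<lambda>k. prob {\<omega>\<in>space M. \<bar>bias (r k) \<omega> - \<kappa>\<bar> > \<tau>}) \<longlonglongrightarrow> 0"
      using bias_tendsto_in_prob[OF assms] \<tau> by (auto simp: tendsto_zero_in_prob_def)
    then have ev2: "\<forall>\<^sub>F k in sequentially. prob {\<omega>\<in>space M. \<bar>bias (r k) \<omega> - \<kappa>\<bar> > \<tau>} < d / 2"
      using d by (intro order_tendstoD(2)) auto
    have "\<forall>\<^sub>F k in sequentially. ?P k < d"
      using ev1 ev2
    proof eventually_elim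
      case (elim k)
      let ?A = "{\<omega>\<in>space M. K \<le> \<bar>score (r k) \<omega>\<bar>}" and ?C = "{\<omega>\<in>space M. \<bar>bias (r k) \<omega> - \<kappa>\<bar> > \<tau>}"
      have "?P k \<le> prob (?A \<union> ?C)"
      proof (intro finite_measure_mono subsetI)
        fix \<omega> assume w: "\<omega> \<in> {\<omega>\<in>space M. \<bar>wilks (r k) \<omega> - (score (r k) \<omega> - \<kappa>)\<^sup>2\<bar> > e}"
        show "\<omega> \<in> ?A \<union> ?C"
        proof (rule ccontr)
          assume "\<omega> \<notin> ?A \<union> ?C"
          then have "\<bar>score (r k) \<omega>\<bar> < K" "\<bar>bias (r k) \<omega> - \<kappa>\<bar> \<le> \<tau>" using w by auto
          from wilks_dist_le[OF r(2) this \<tau>(2), folded B_def] w elim(1) \<tau>B show False by simp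
        qed
      qed measurable
      also have "\<dots> \<le> prob ?A + prob ?C" by (rule measure_Un_le) measurable
      also have "prob ?A \<le> d / 2" using score_tail[OF r(2) K(1)] by (simp add: K(2))
      finally show "?P k < d" using elim(2) by simp
    qed
    then show "\<exists>N. \<forall>k\<ge>N. norm (?P k - 0) < d" by (auto simp: eventually_sequentially)
  qed
qed

lemma score_image_law:
  assumes "1 \<le> n" "f \<in> borel_measurable borel"
  shows "distr M borel (\<lambda>\<omega>. f (score n \<omega>)) = distr std_normal_distribution borel f"
  unfolding score_law[OF assms(1), symmetric] using assms(2)
  by (subst distr_distr) (auto simp: comp_def)

lemma score_bias_weak_conv:
  assumes r: "strict_mono r" "\<And>k. 1 \<le> r k" and lim: "(\<lambda>k. dim_ratio (r k)) \<longlonglongrightarrow> \<kappa>"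
  shows "weak_conv_m (\<lambda>k. distr M borel (\<lambda>\<omega>. score (r k) \<omega> - bias (r k) \<omega>))
           (distr std_normal_distribution borel (\<lambda>x. x - \<kappa>))"
proof (rule weak_conv_m_if_diff_tendsto_zero[where Z = "\<lambda>k \<omega>. score (r k) \<omega> - \<kappa>"])
  show "distr M borel (\<lambda>\<omega>. score (r k) \<omega> - \<kappa>) = distr std_normal_distribution borel (\<lambda>x. x - \<kappa>)" for k
    using r by (intro score_image_law) auto
  show "tendsto_zero_in_prob M (\<lambda>k \<omega>. score (r k) \<omega> - bias (r k) \<omega> - (score (r k) \<omega> - \<kappa>))"
    using bias_tendsto_in_prob[OF assms] by (simp add: tendsto_zero_in_prob_def abs_minus_commute)
qed measurable

lemma wilks_weak_conv:
  assumes r: "strict_mono r" "\<And>k. 1 \<le> r k" and lim: "(\<lambda>k. dim_ratio (r k)) \<longlonglongrightarrow> \<kappa>"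
  shows "weak_conv_m (\<lambda>k. distr M borel (wilks (r k))) (distr std_normal_distribution borel (\<lambda>x. (x - \<kappa>)\<^sup>2))"
proof (rule weak_conv_m_if_diff_tendsto_zero[OF _ _ _ wilks_tendsto_in_prob[OF assms]])
  show "distr M borel (\<lambda>\<omega>. (score (r k) \<omega> - \<kappa>)\<^sup>2) = distr std_normal_distribution borel (\<lambda>x. (x - \<kappa>)\<^sup>2)" for k
    using r by (intro score_image_law[where f = "\<lambda>x. (x - \<kappa>)\<^sup>2"]) auto
qed measurable

section \<open>Failure of root-n consistency and divergence of the bias\<close>

lemma not_tight_of_unbounded:
  assumes "\<not> Bseq dim_ratio"
  shows "\<not> tight (\<lambda>n. distr M borel (\<lambda>\<omega>. score n \<omega> - bias n \<omega>))"
proof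
  assume "tight (\<lambda>n. distr M borel (\<lambda>\<omega>. score n \<omega> - bias n \<omega>))"
  then obtain a b :: real
    where ab: "\<And>n. measure (distr M borel (\<lambda>\<omega>. score n \<omega> - bias n \<omega>)) {a<..b} > 1 - 1 / 2"
    unfolding tight_def by (metis half_gt_zero zero_less_one)
  \<comment> \<open>If \<open>\<bar>score\<bar> < 2\<close> and \<open>bias > 2 - a\<close>, then
    \<open>score - bias < a\<close>; for this \<open>n\<close> the interval thus carries mass at
    most \<open>1 / 2\<close>.\<close>
  obtain n where n: "1 \<le> n" "2 * (2 - a) + 7 \<le> dim_ratio n"
    using not_Bseq_nonneg_frequently_ge[OF assms dim_ratio_nonneg, of 1 "2 * (2 - a) + 7"] by auto
  have "measure (distr M borel (\<lambda>\<omega>. score n \<omega> - bias n \<omega>)) {a<..b}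
      = prob ((\<lambda>\<omega>. score n \<omega> - bias n \<omega>) -` {a<..b} \<inter> space M)"
    by (rule measure_distr) measurable
  also have "\<dots> \<le> prob {\<omega>\<in>space M. 2 \<le> \<bar>score n \<omega>\<bar> \<or> bias n \<omega> \<le> 2 - a}"
    by (intro finite_measure_mono) auto
  also have "\<dots> \<le> 1 / 2" by (rule score_bias_tail[OF n])
  finally show False using ab[of n] by simp
qed

text \<open>Tightness bounds the dimension ratio, so some subsequence has a limit
  \<open>\<kappa> \<noteq> 0\<close>. Along it the error law tends to that of
  \<open>Z - \<kappa>\<close> for a standard normal \<open>Z\<close>, whose mean
  \<open>- \<kappa>\<close> contradicts centring.\<close>

lemma not_root_n_consistent_law:
  assumes "\<not> dim_ratio \<longlonglongrightarrow> 0"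
    and tight: "tight (\<lambda>n. distr M borel (\<lambda>\<omega>. score n \<omega> - bias n \<omega>))"
    and mean: "\<And>r \<nu>. strict_mono (r :: nat \<Rightarrow> nat) \<Longrightarrow> real_distribution \<nu> \<Longrightarrow>
      weak_conv_m (\<lambda>k. distr M borel (\<lambda>\<omega>. score (r k) \<omega> - bias (r k) \<omega>)) \<nu> \<Longrightarrow>
      has_bochner_integral \<nu> (\<lambda>x. x) 0"
  shows False
proof -
  have "Bseq dim_ratio" using not_tight_of_unbounded tight by blast
  then obtain r \<kappa> where r: "strict_mono (r :: nat \<Rightarrow> nat)" "\<And>k. 1 \<le> r k" "\<kappa> \<noteq> 0"
    "(\<lambda>k. dim_ratio (r k)) \<longlonglongrightarrow> \<kappa>"
    using Bseq_not_null_subseq_limit assms(1) by blast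
  have "has_bochner_integral (distr std_normal_distribution borel (\<lambda>x. x - \<kappa>)) (\<lambda>x. x) 0"
    by (intro mean[OF r(1)] real_distribution_std_normal_image score_bias_weak_conv r) auto
  then have "(\<integral>x. x \<partial>distr std_normal_distribution borel (\<lambda>x. x - \<kappa>)) = 0"
    by (rule has_bochner_integral_integral_eq)
  then show False using r(3) by (simp add: integral_distr std_normal_shift_mean)
qed

lemma bias_diverges:
  assumes "(\<lambda>n. sqrt (real n)) \<in> o(\<lambda>n. real (p n))"
  shows "AE \<omega> in M. filterlim (\<lambda>n. bias n \<omega>) at_top sequentially"
proof -
  \<comment> \<open>The first Borel-Cantelli lemma is applied to natural thresholds
    \<open>B\<close>, so that only countably many null sets are discarded.\<close>
  have "AE \<omega> in M. \<forall>\<^sub>F n in sequentially. \<omega> \<in> space M - {\<omega>\<in>space M. bias n \<omega> \<le> B}" for B :: nat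
  proof (rule borel_cantelli_AE1[where A = "\<lambda>n. {\<omega>\<in>space M. bias n \<omega> \<le> B}"])
    show "{\<omega>\<in>space M. bias n \<omega> \<le> B} \<in> sets M" for n by measurable
    show "emeasure M {\<omega>\<in>space M. bias n \<omega> \<le> B} < \<infinity>" for n by (simp add: emeasure_eq_measure)
    \<comment> \<open>The constant is the one required by \<open>bias_lower_tail\<close> with
      \<open>c = 1\<close>, giving the summable bound \<open>exp (- sqrt n)\<close>.\<close>
    have "\<forall>\<^sub>F n in sequentially. norm (sqrt (real n)) \<le> 1 / (2 * B + 2 * 1 + 1) * norm (real (p n))"
      by (rule landau_o.smallD[OF assms]) (simp add: add_nonneg_pos)
    then have "\<forall>\<^sub>F n in sequentially. norm (prob {\<omega>\<in>space M. bias n \<omega> \<le> B}) \<le> exp (- sqrt (real n))"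
      using eventually_ge_at_top[of 1]
    proof eventually_elim
      case (elim n)
      have "0 < 2 * real B + 2 * 1 + 1" by simp
      then have "(2 * real B + 2 * 1 + 1) * sqrt n \<le> p n" using elim(1) by (simp add: field_simps)
      from bias_lower_tail[OF elim(2) this] show ?case by simp
    qed
    then show "summable (\<lambda>n. prob {\<omega>\<in>space M. bias n \<omega> \<le> B})"
      by (rule summable_comparison_test_ev) (rule summable_exp_neg_sqrt)
  qed
  then have "AE \<omega> in M. \<forall>B::nat. \<forall>\<^sub>F n in sequentially. \<omega> \<in> space M - {\<omega>\<in>space M. bias n \<omega> \<le> B}"
    by (simp add: AE_all_countable)
  then show ?thesis
  proof eventually_elim
    case (elim \<omega>)
    show ?case unfolding filterlim_at_top
    proof
      fix Z :: real
      obtain B :: nat where "Z \<le> B" using real_arch_simple by blast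
      with elim[rule_format, of B] show "\<forall>\<^sub>F n in sequentially. Z \<le> bias n \<omega>"
        by (auto elim!: eventually_mono)
    qed
  qed
qed

section \<open>The Wilks phenomenon\<close>

lemma wilks_weak_conv_iff:
  "weak_conv_m (\<lambda>n. distr M borel (wilks n)) chi_square_1 \<longleftrightarrow> dim_ratio \<longlonglongrightarrow> 0"
proof
  assume "dim_ratio \<longlonglongrightarrow> 0"
  \<comment> \<open>The subsequence result requires indices at least 1; dropping the index 0 does
    not affect the limit.\<close>
  then have "(\<lambda>k. dim_ratio (Suc k)) \<longlonglongrightarrow> 0" by (rule LIMSEQ_Suc)
  then have "weak_conv_m (\<lambda>k. distr M borel (wilks (Suc k))) chi_square_1"
    using wilks_weak_conv[of Suc 0] by (simp add: chi_square_1_def strict_mono_Suc_iff)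
  then show "weak_conv_m (\<lambda>n. distr M borel (wilks n)) chi_square_1"
    unfolding weak_conv_m_def weak_conv_def by (auto intro: LIMSEQ_imp_Suc)
next
  interpret C: real_distribution chi_square_1
    unfolding chi_square_1_def by (intro real_distribution_std_normal_image) auto
  assume conv: "weak_conv_m (\<lambda>n. distr M borel (wilks n)) chi_square_1"
  have dw: "real_distribution (distr M borel (wilks n))" for n by (rule real_distribution_distr) simp
  have bdd: "Bseq dim_ratio"
  proof (rule ccontr)
    assume "\<not> Bseq dim_ratio"
    have "\<forall>\<^sub>F c in at_top. 1 / 2 < cdf chi_square_1 c"
      by (rule order_tendstoD(1)[OF C.cdf_lim_at_top_prob]) simp
    then have "\<forall>\<^sub>F c in at_top. 1 / 2 < cdf chi_square_1 c \<and> 0 \<le> c"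
      using eventually_ge_at_top[of 0] by eventually_elim auto
    then obtain c where c: "1 / 2 < cdf chi_square_1 c" "0 \<le> c"
      by (auto simp: eventually_at_top_linorder)
    have "(\<lambda>n. cdf (distr M borel (wilks n)) c) \<longlonglongrightarrow> cdf chi_square_1 c"
      using conv chi_square_1_continuous by (auto simp: weak_conv_m_def weak_conv_def)
    then have "\<forall>\<^sub>F n in sequentially. 1 / 2 < cdf (distr M borel (wilks n)) c"
      using c by (intro order_tendstoD(1)) auto
    then obtain N where N: "\<And>n. N \<le> n \<Longrightarrow> 1 / 2 < cdf (distr M borel (wilks n)) c"
      by (auto simp: eventually_sequentially)
    \<comment> \<open>The threshold of \<open>wilks_large\<close> for \<open>K = 2\<close>. With
      \<open>dim_ratio n\<close> large, the statistic is at most \<open>c\<close> with probability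
      at most \<open>1 / 2\<close>, although the limiting distribution function exceeds
      \<open>1 / 2\<close> at \<open>c\<close>.\<close>
    let ?B = "4 * (2 + c + 1)"
    obtain n where n: "max 1 N \<le> n" "2 * ?B + 7 \<le> dim_ratio n"
      using not_Bseq_nonneg_frequently_ge[OF \<open>\<not> Bseq dim_ratio\<close> dim_ratio_nonneg] by blast
    have "cdf (distr M borel (wilks n)) c = prob (wilks n -` {..c} \<inter> space M)"
      unfolding cdf_def by (rule measure_distr) measurable
    also have "\<dots> \<le> prob {\<omega>\<in>space M. 2 \<le> \<bar>score n \<omega>\<bar> \<or> bias n \<omega> \<le> ?B}"
    proof (intro finite_measure_mono subsetI)
      fix \<omega> assume "\<omega> \<in> wilks n -` {..c} \<inter> space M"
      then show "\<omega> \<in> {\<omega>\<in>space M. 2 \<le> \<bar>score n \<omega>\<bar> \<or> bias n \<omega> \<le> ?B}"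
        using wilks_large[of n c \<omega> 2] n c by (auto simp: not_le[symmetric])
    qed measurable
    also have "\<dots> \<le> 1 / 2" using n by (intro score_bias_tail) auto
    finally show False using N[of n] n by simp
  qed
  show "dim_ratio \<longlonglongrightarrow> 0"
  proof (rule ccontr)
    assume "\<not> dim_ratio \<longlonglongrightarrow> 0"
    then obtain r \<kappa> where r: "strict_mono (r :: nat \<Rightarrow> nat)" "\<And>k. 1 \<le> r k" "\<kappa> \<noteq> 0"
      "(\<lambda>k. dim_ratio (r k)) \<longlonglongrightarrow> \<kappa>"
      using Bseq_not_null_subseq_limit[OF bdd] by blast
    let ?\<nu> = "distr std_normal_distribution borel (\<lambda>x. (x - \<kappa>)\<^sup>2)"
    have \<nu>: "real_distribution ?\<nu>" by (intro real_distribution_std_normal_image) auto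
    \<comment> \<open>Along the subsequence the statistic converges both to the law of
      \<open>(Z - \<kappa>)^2\<close> and to \<open>chi_square_1\<close>. These laws must coincide,
      but their means are \<open>1 + \<kappa>^2\<close> and 1.\<close>
    have "char ?\<nu> = char chi_square_1"
    proof
      fix t
      have "(\<lambda>k. char (distr M borel (wilks (r k))) t) \<longlonglongrightarrow> char ?\<nu> t"
        using wilks_weak_conv[OF r(1,2,4)] by (intro levy_continuity1 dw \<nu>)
      moreover have "(\<lambda>k. char (distr M borel (wilks (r k))) t) \<longlonglongrightarrow> char chi_square_1 t"
        using LIMSEQ_subseq_LIMSEQ[OF levy_continuity1[OF dw _ conv] r(1)]
          C.real_distribution_axioms by (simp add: comp_def)
      ultimately show "char ?\<nu> t = char chi_square_1 t" by (rule LIMSEQ_unique)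
    qed
    then have "?\<nu> = chi_square_1" by (intro Levy_uniqueness \<nu> C.real_distribution_axioms)
    then have "(\<integral>x. x \<partial>?\<nu>) = (\<integral>x. x \<partial>chi_square_1)" by simp
    then show False using r(3)
      by (simp add: chi_square_1_def integral_distr std_normal_shift_sq_mean std_normal_moments)
  qed
qed

end

text \<open>On \<open>space M\<close> the root-n error is \<open>score - bias\<close>, the
  normalized score is \<open>score\<close> and the Wilks statistic is \<open>wilks\<close>, so each
  claim becomes one about these three sequences.\<close>

theorem proposition2p5:
  fixes M :: "'a measure"
    and p :: "nat \<Rightarrow> nat"
    and \<epsilon> Y :: "nat \<Rightarrow> nat \<Rightarrow> 'a \<Rightarrow> nat \<Rightarrow> real"
    and \<theta>\<^sub>0 :: real and \<eta>\<^sub>0 :: "nat \<Rightarrow> real"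
    and \<theta>_hat \<xi> :: "nat \<Rightarrow> 'a \<Rightarrow> real"
    and L_prof :: "nat \<Rightarrow> 'a \<Rightarrow> real \<Rightarrow> real"
  assumes "prob_space M"
    and "\<And>n. 1 \<le> p n"
    and "\<And>n. prob_space.indep_vars M (\<lambda>_. borel_vec (p n)) (\<epsilon> n) {1..n}"
    and "\<And>n i. i \<in> {1..n} \<Longrightarrow> distr M (borel_vec (p n)) (\<epsilon> n i) = std_gaussian_vec (p n)"
    and "\<theta>\<^sub>0 = 0" and "\<And>k. \<eta>\<^sub>0 k = 0"
    and "\<And>n i \<omega> j. i \<in> {1..n} \<Longrightarrow> \<omega> \<in> space M \<Longrightarrow> j < p n \<Longrightarrow>
           Y n i \<omega> j = model_map (p n) \<theta>\<^sub>0 \<eta>\<^sub>0 j + \<epsilon> n i \<omega> j"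
    and "\<And>n \<omega>. L_prof n \<omega> = profile_loglik (p n) n (\<lambda>i. Y n i \<omega>)"
    and "\<And>n \<omega>. \<theta>_hat n \<omega> = profile_MLE (p n) n (\<lambda>i. Y n i \<omega>)"
    and "\<And>n \<omega>. \<xi> n \<omega> = (\<Sum>i=1..n. \<epsilon> n i \<omega> 0) / sqrt (real n)"
  shows
    "((\<lambda>n. real (p n) / sqrt (real n)) \<longlonglongrightarrow> 0 \<longrightarrow>
        tendsto_zero_in_prob M (\<lambda>n \<omega>. sqrt (real n) * (\<theta>_hat n \<omega> - \<theta>\<^sub>0) - \<xi> n \<omega>))
   \<and> (\<not> (\<lambda>n. real (p n) / sqrt (real n)) \<longlonglongrightarrow> 0 \<longrightarrow>
        \<not> root_n_consistent M \<theta>_hat \<theta>\<^sub>0 \<and>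
        (\<not> Bseq (\<lambda>n. real (p n) / sqrt (real n)) \<longrightarrow> \<not> tight (root_n_error_law M \<theta>_hat \<theta>\<^sub>0)))
   \<and> ((\<lambda>n. sqrt (real n)) \<in> o(\<lambda>n. real (p n)) \<longrightarrow>
        (AE \<omega> in M. filterlim (\<lambda>n. \<bar>sqrt (real n) * (\<theta>_hat n \<omega> - \<theta>\<^sub>0) - \<xi> n \<omega>\<bar>)
                        at_top sequentially))
   \<and> (weak_conv_m (\<lambda>n. distr M borel (\<lambda>\<omega>. 2 * (L_prof n \<omega> (\<theta>_hat n \<omega>) - L_prof n \<omega> \<theta>\<^sub>0))) chi_square_1
        \<longleftrightarrow> (\<lambda>n. real (p n)) \<in> o(\<lambda>n. sqrt (real n)))"
proof -
  interpret quadratic_model M p \<epsilon>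
    using assms(1-4) by (auto simp: quadratic_model_def quadratic_model_axioms_def)
  note \<theta>\<^sub>0 = \<open>\<theta>\<^sub>0 = 0\<close>
  \<comment> \<open>At the true parameter 0 the model map vanishes, so the observations are the
    noise itself on the coordinates below \<open>p n\<close>.\<close>
  have mean_Y: "sample_mean n (\<lambda>i. Y n i \<omega>) j = noise_mean n \<omega> j" if "\<omega> \<in> space M" "j < p n" for n \<omega> j
    using that assms(6,7) \<theta>\<^sub>0 by (simp add: noise_mean_def sample_mean_def model_map_def L2_set_def)
  have error: "sqrt n * (\<theta>_hat n \<omega> - \<theta>\<^sub>0) = score n \<omega> - bias n \<omega>" if "\<omega> \<in> space M" for n \<omega>
  proof (cases "n = 0")
    case False
    let ?z = "sample_mean n (\<lambda>i. Y n i \<omega>)"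
    have "L2_set ?z {1..<p n} = L2_set (noise_mean n \<omega>) {1..<p n}"
      using mean_Y[OF that] by (intro L2_set_cong) auto
    then have "\<theta>_hat n \<omega> = noise_mean n \<omega> 0 - (L2_set (noise_mean n \<omega>) {1..<p n})\<^sup>2"
      using False p_pos[of n] mean_Y[OF that, of 0] by (simp add: assms(9) profile_MLE_eq)
    then show ?thesis by (simp add: \<theta>\<^sub>0 score_def bias_def right_diff_distrib)
  qed (simp add: score_def bias_def)
  have \<xi>: "\<xi> n \<omega> = score n \<omega>" for n \<omega>
  proof -
    have "S / sqrt n = S * (sqrt n / n)" for S :: real
      unfolding sqrt_divide_self_eq[OF of_nat_0_le_iff] by (rule divide_inverse)
    then show ?thesis
      using p_pos[of n] by (simp add: assms(10) score_def noise_mean_def sample_mean_def mult.commute)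
  qed
  have diff: "sqrt n * (\<theta>_hat n \<omega> - \<theta>\<^sub>0) - \<xi> n \<omega> = - bias n \<omega>" if "\<omega> \<in> space M" for n \<omega>
    using error[OF that] by (simp add: \<xi>)
  have wilks: "2 * (L_prof n \<omega> (\<theta>_hat n \<omega>) - L_prof n \<omega> \<theta>\<^sub>0) = wilks n \<omega>" if "\<omega> \<in> space M" for n \<omega>
  proof (cases "n = 0")
    \<comment> \<open>For \<open>n = 0\<close> the log-likelihood is an empty sum, so both sides are
      0.\<close>
    case True
    then show ?thesis by (simp add: assms(8) wilks_def profile_loglik_def loglik_def)
  next
    case False
    then have "2 * (L_prof n \<omega> (\<theta>_hat n \<omega>) - L_prof n \<omega> \<theta>\<^sub>0) = n * min_misfit (p n) (sample_mean n (\<lambda>i. Y n i \<omega>)) 0"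
      unfolding assms(8) assms(9) \<theta>\<^sub>0 using p_pos[of n] by (intro wilks_stat_eq) auto
    also have "min_misfit (p n) (sample_mean n (\<lambda>i. Y n i \<omega>)) 0 = min_misfit (p n) (noise_mean n \<omega>) 0"
      using mean_Y[OF that] p_pos[of n] by (intro min_misfit_cong) auto
    finally show ?thesis by (simp add: wilks_def)
  qed
  have law: "root_n_error_law M \<theta>_hat \<theta>\<^sub>0 = (\<lambda>n. distr M borel (\<lambda>\<omega>. score n \<omega> - bias n \<omega>))"
    unfolding root_n_error_law_def using error by (intro ext distr_cong) auto
  have wlaw: "(\<lambda>n. distr M borel (\<lambda>\<omega>. 2 * (L_prof n \<omega> (\<theta>_hat n \<omega>) - L_prof n \<omega> \<theta>\<^sub>0)))
      = (\<lambda>n. distr M borel (wilks n))"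
    using wilks by (intro ext distr_cong) auto
  have ratio: "(\<lambda>n. real (p n) / sqrt (real n)) = dim_ratio" by (simp add: dim_ratio_def fun_eq_iff)
  have smallo: "(\<lambda>n. real (p n)) \<in> o(\<lambda>n. sqrt (real n)) \<longleftrightarrow> dim_ratio \<longlonglongrightarrow> 0"
  proof
    assume "(\<lambda>n. real (p n)) \<in> o(\<lambda>n. sqrt (real n))"
    from smalloD_tendsto[OF this] show "dim_ratio \<longlonglongrightarrow> 0" by (simp add: ratio)
  next
    assume "dim_ratio \<longlonglongrightarrow> 0"
    \<comment> \<open>The quotient criterion for little-o requires an eventually nonzero
      denominator; only \<open>n = 0\<close> fails.\<close>
    moreover have "\<forall>\<^sub>F n in sequentially. sqrt (real n) \<noteq> 0"
      using eventually_gt_at_top[of 0] by eventually_elim simp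
    ultimately show "(\<lambda>n. real (p n)) \<in> o(\<lambda>n. sqrt (real n))"
      by (intro smalloI_tendsto) (simp_all add: ratio)
  qed
  have part1: "tendsto_zero_in_prob M (\<lambda>n \<omega>. sqrt n * (\<theta>_hat n \<omega> - \<theta>\<^sub>0) - \<xi> n \<omega>)" if "dim_ratio \<longlonglongrightarrow> 0"
    unfolding tendsto_zero_in_prob_def
  proof (intro allI impI)
    fix e :: real assume "0 < e"
    have "(\<lambda>k. dim_ratio (Suc k)) \<longlonglongrightarrow> 0" using that by (rule LIMSEQ_Suc)
    from bias_tendsto_in_prob[OF _ _ this] \<open>0 < e\<close>
    have "(\<lambda>k. prob {\<omega>\<in>space M. \<bar>bias (Suc k) \<omega>\<bar> > e}) \<longlonglongrightarrow> 0"
      by (simp add: tendsto_zero_in_prob_def strict_mono_Suc_iff)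
    then have "(\<lambda>n. prob {\<omega>\<in>space M. \<bar>bias n \<omega>\<bar> > e}) \<longlonglongrightarrow> 0" by (rule LIMSEQ_imp_Suc)
    moreover have "{\<omega>\<in>space M. \<bar>sqrt n * (\<theta>_hat n \<omega> - \<theta>\<^sub>0) - \<xi> n \<omega>\<bar> > e} = {\<omega>\<in>space M. \<bar>bias n \<omega>\<bar> > e}" for n
      using diff by auto
    ultimately show "(\<lambda>n. prob {\<omega>\<in>space M. \<bar>sqrt n * (\<theta>_hat n \<omega> - \<theta>\<^sub>0) - \<xi> n \<omega>\<bar> > e}) \<longlonglongrightarrow> 0"
      by simp
  qed
  have part2: "\<not> root_n_consistent M \<theta>_hat \<theta>\<^sub>0" if "\<not> dim_ratio \<longlonglongrightarrow> 0"
    using not_root_n_consistent_law[OF that]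
    unfolding root_n_consistent_def law by (auto simp: comp_def)
  have part3: "AE \<omega> in M. filterlim (\<lambda>n. \<bar>sqrt n * (\<theta>_hat n \<omega> - \<theta>\<^sub>0) - \<xi> n \<omega>\<bar>) at_top sequentially"
    if "(\<lambda>n. sqrt (real n)) \<in> o(\<lambda>n. real (p n))"
    using bias_diverges[OF that] AE_space
    by eventually_elim (simp add: diff bias_nonneg)
  show ?thesis
    unfolding ratio wlaw smallo wilks_weak_conv_iff
    using part1 part2 part3 not_tight_of_unbounded by (simp add: law)
qed

end
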